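(* Let $0\le p\le k$, $k\ge1$. Let $(V_1,\ldots,V_k)$ be a $k$-tuple of doubly $\Lambda$-commuting row isometries on a Hilbert space $\mathcal K$ such that $V_1,\ldots,V_p$ (if $p\ge1$) are pure row isometries and $V_{p+1},\ldots,V_k$ (if $p\le k-1$) are Cuntz row isometries. Let $\mathcal L$ be the $\{1,\ldots,p\}$-wandering subspace of $(V_1,\ldots,V_k)$ and let $\widetilde W_{p+1}:=V_{p+1}|_{\mathcal L},\ldots,\widetilde W_k:=V_k|_{\mathcal L}$. Then the $k$-tuple $(V_1,\ldots,V_k)$ is unitarily equivalent to (i) the standard $k$-tuple $(\mathbf S_1,\ldots,\mathbf S_p,W_{p+1},\ldots,W_k)$ associated with the wandering $\{1,\ldots,p\}$-data $\{\mathcal L,(\widetilde W_{p+1},\ldots,\widetilde W_k)\}$, if $1\le p\le k-1$; (ii) the standard $k$-tuple $(V_1,\ldots,V_k)$ associated with the wandering $\emptyset$-data $\{\mathcal K,(V_1,\ldots,V_k)\}$, if $p=0$; (iii) the standard $k$-tuple $(\mathbf S_1,\ldots,\mathbf S_k)$ associated with the wandering $\{1,\ldots,k\}$-data $\{\mathcal L\}$, if $p=k$.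
   Context: Fix integers $k\ge1$, $n_1,\ldots,n_k\ge 1$ and, for $i\ne j$ in $\{1,\ldots,k\}$, an $n_i\times n_j$ matrix $\Lambda_{i,j}=[\lambda_{i,j}(s,t)]$ with entries in $\mathbb T=\{z\in\mathbb C:|z|=1\}$, such that $\lambda_{j,i}(t,s)=\overline{\lambda_{i,j}(s,t)}$. A row isometry $V_i=[V_{i,1}\cdots V_{i,n_i}]$ on $\mathcal K$ consists of $V_{i,s}\in B(\mathcal K)$ with $V_{i,s}^*V_{i,t}=\delta_{st}I$. Row isometries $V_1,\ldots,V_k$ are doubly $\Lambda$-commuting if $V_{i,s}^*V_{j,t}=\overline{\lambda_{i,j}(s,t)}\,V_{j,t}V_{i,s}^*$ for all $i\neq j$ and all $s,t$. $\mathbb F_{n_i}^+$ is the unital free semigroup with generators $g_1^i,\ldots,g_{n_i}^i$ and neutral element $g_0^i$; $V_{i,\alpha}:=V_{i,p_1}\cdots V_{i,p_m}$ for $\alpha=g^i_{p_1}\cdots g^i_{p_m}$, $V_{i,g_0^i}:=I$. $V_i$ is Cuntz if $\sum_sV_{i,s}V_{i,s}^*=I$; it is pure if there is a subspace $\mathcal M$ with $\mathcal M\perp V_{i,\alpha}\mathcal M$ for $|\alpha|\ge1$ and $\mathcal K=\bigoplus_{\alpha}V_{i,\alpha}\mathcal M$. The $\{1,\ldots,p\}$-wandering subspace of $(V_1,\ldots,V_k)$ is $$\mathcal L=\bigcap_{m_{p+1},\ldots,m_k=0}^\infty\ \bigoplus_{|\alpha_{p+1}|=m_{p+1}}\cdots\bigoplus_{|\alpha_k|=m_k}V_{p+1,\alpha_{p+1}}\cdots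 V_{k,\alpha_k}\Big(\bigcap_{1\le i\le p,\,1\le s\le n_i}\ker V_{i,s}^*\Big),$$ where $\alpha_j\in\mathbb F^+_{n_j}$, with the evident conventions for $p=k$ ($\mathcal L=\bigcap_{i,s}\ker V_{i,s}^*$) and $p=0$ (the intersection of kernels is $\mathcal K$). It is reducing for $V_{j,t}$, $j>p$, and the restrictions are doubly $\Lambda$-commuting Cuntz row isometries on $\mathcal L$. Standard $k$-tuple associated with $\{\mathcal L,(\widetilde W_{p+1},\ldots,\widetilde W_k)\}$, where $\widetilde W_j=[\widetilde W_{j,1}\cdots\widetilde W_{j,n_j}]$ are doubly $\Lambda$-commuting Cuntz row isometries on $\mathcal L$: put $\boldsymbol\lambda_{i,j}(s,\beta):=\prod_{b=1}^q\lambda_{i,j}(s,j_b)$ if $\beta=g^j_{j_1}\cdots g^j_{j_q}\in\mathbb F_{n_j}^+$ and $\boldsymbol\lambda_{i,j}(s,g_0^j):=1$. On $\ell^2(\mathbb F_{n_1}^+\times\cdots\times\mathbb F_{n_p}^+)\otimes\mathcal L$, with $\{\chi_{(\alpha_1,\ldots,\alpha_p)}\}$ the standard orthonormal basis of the $\ell^2$ space, define for $i\le p$ $$\mathbf S_{i,s}(\chi_{(\alpha_1,\ldots,\alpha_p)}\otimes h)=\boldsymbol\lambda_{i,1}(s,\alpha_1)\cdots\boldsymbol\lambda_{i,i-1}(s,\alpha_{i-1})\,\chi_{(\alpha_1,\ldots,\alpha_{i-1},g_s^i\alpha_i,\alpha_{i+1},\ldots,\alpha_p)}\otimes h$$ (no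 scalar factor if $i=1$), and for $i>p$ $$W_{i,s}(\chi_{(\alpha_1,\ldots,\alpha_p)}\otimes h)=\boldsymbol\lambda_{i,1}(s,\alpha_1)\cdots\boldsymbol\lambda_{i,p}(s,\alpha_p)\,\chi_{(\alpha_1,\ldots,\alpha_p)}\otimes\widetilde W_{i,s}h.$$ For $p=k$ only the $\mathbf S_i$ occur (the data is just $\mathcal L$); for $p=0$ the space is $\mathcal L$ and $W_{i,s}=\widetilde W_{i,s}$. $k$-tuples $(V_i)$ on $\mathcal K$ and $(V_i')$ on $\mathcal K'$ are unitarily equivalent if there is a unitary $U:\mathcal K\to\mathcal K'$ with $UV_{i,s}=V'_{i,s}U$ for all $i,s$. *)

theory Defs
  imports "HOL-Analysis.Analysis"
begin

section \<open>Complex Hilbert spaces\<close>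

text \<open>
  The inner product \<open>cinner\<close> is linear in its first argument. Its real part is the library's
  \<^const>\<open>inner\<close>, so norm, topology and completeness are those of the underlying real
  inner product space.
\<close>

class complex_inner = real_inner +
  fixes scaleC :: "complex \<Rightarrow> 'a \<Rightarrow> 'a" (infixr "*\<^sub>C" 75)
    and cinner :: "'a \<Rightarrow> 'a \<Rightarrow> complex"
  assumes scaleC_add_right: "a *\<^sub>C (x + y) = a *\<^sub>C x + a *\<^sub>C y"
    and scaleC_add_left: "(a + b) *\<^sub>C x = a *\<^sub>C x + b *\<^sub>C x"
    and scaleC_scaleC: "a *\<^sub>C (b *\<^sub>C x) = (a * b) *\<^sub>C x"
    and scaleC_of_real: "complex_of_real r *\<^sub>C x = r *\<^sub>R x"
    and cinner_commute: "cinner x y = cnj (cinner y x)"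
    and cinner_add_left: "cinner (x + y) z = cinner x z + cinner y z"
    and cinner_scaleC_left: "cinner (a *\<^sub>C x) y = a * cinner x y"
    and Re_cinner: "Re (cinner x y) = inner x y"

class chilbert_space = complex_inner + complete_space

global_interpretation complex_vector: vector_space "scaleC :: complex \<Rightarrow> 'a \<Rightarrow> 'a::complex_inner"
  defines csubspace = complex_vector.subspace
    and cspan = complex_vector.span
proof
  show "1 *\<^sub>C x = x" for x :: 'a
    using scaleC_of_real[of 1 x] by simp
qed (simp_all add: scaleC_add_right scaleC_add_left scaleC_scaleC)

lemma cinner_self: "cinner x x = complex_of_real ((norm x)\<^sup>2)"
proof (rule complex_eqI)
  show "Re (cinner x x) = Re (complex_of_real ((norm x)\<^sup>2))"
    by (simp add: Re_cinner power2_norm_eq_inner)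
  have "Im (cinner x x) = - Im (cinner x x)"
    by (metis cinner_commute cnj.sel(2))
  then show "Im (cinner x x) = Im (complex_of_real ((norm x)\<^sup>2))"
    by simp
qed

lemma norm_scaleC: "norm (a *\<^sub>C x) = cmod a * norm x"
proof -
  have "complex_of_real ((norm (a *\<^sub>C x))\<^sup>2) = a * cnj (a * cinner x x)"
    by (metis cinner_self cinner_commute cinner_scaleC_left)
  also have "\<dots> = complex_of_real ((cmod a * norm x)\<^sup>2)"
    by (simp add: cinner_self complex_norm_square[symmetric] power_mult_distrib
        mult.assoc[symmetric] flip: of_real_power)
  finally have "(norm (a *\<^sub>C x))\<^sup>2 = (cmod a * norm x)\<^sup>2"
    using of_real_eq_iff by blast
  then show ?thesis
    by (simp add: power2_eq_iff_nonneg)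
qed

lemma cmod_cinner_le: "cmod (cinner x y) \<le> norm x * norm y"
proof (cases "cinner x y = 0")
  case False
  define c where "c = cnj (sgn (cinner x y))"
  have c: "cmod c = 1"
    using False by (simp add: c_def norm_sgn)
  have "c * cinner x y = complex_of_real (cmod (cinner x y))"
    using False unfolding c_def sgn_eq
    by (simp add: complex_norm_square[symmetric] mult.commute power2_eq_square scaleR_conv_of_real)
  then have "cmod (cinner x y) = Re (cinner (c *\<^sub>C x) y)"
    by (simp add: cinner_scaleC_left)
  also have "\<dots> \<le> norm (c *\<^sub>C x) * norm y"
    using norm_cauchy_schwarz by (simp add: Re_cinner)
  finally show ?thesis
    by (simp add: norm_scaleC c)
qed simp


section \<open>Square-summable families\<close>

text \<open>
  \<open>('i, 'a) l2\<close> is the Hilbert space \<open>\<ell>\<^sup>2(I; H)\<close> of square-summable \<open>H\<close>-valued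
  functions on \<open>I\<close>. It serves as \<open>\<ell>\<^sup>2(I) \<otimes> H\<close>: the elementary tensor of the basis
  vector at \<open>i\<close> with \<open>h\<close> is the function \<open>l2_tensor i h\<close> below, supported at \<open>i\<close> with
  value \<open>h\<close>. For \<open>X \<subseteq> I\<close> and a closed subspace \<open>L\<close> of \<open>H\<close>, the space
  \<open>\<ell>\<^sup>2(X) \<otimes> L\<close> is the closed subspace of functions that vanish outside \<open>X\<close> and take
  values in \<open>L\<close>.
\<close>

typedef (overloaded) ('i, 'a) l2 =
  "{f :: 'i \<Rightarrow> 'a::complex_inner. (\<lambda>i. (norm (f i))\<^sup>2) summable_on UNIV}"
  by (rule exI[of _ "\<lambda>_. 0"]) simp

setup_lifting type_definition_l2

lemma sq_norm_add_le: "(norm (x + y))\<^sup>2 \<le> 2 * (norm x)\<^sup>2 + 2 * (norm (y::'a::real_normed_vector))\<^sup>2"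
proof -
  have "(norm (x + y))\<^sup>2 \<le> (norm x + norm y)\<^sup>2"
    by (simp add: norm_triangle_ineq power_mono)
  also have "\<dots> \<le> 2 * (norm x)\<^sup>2 + 2 * (norm y)\<^sup>2"
    using sum_squares_bound[of "norm x" "norm y"] by (simp add: power2_sum)
  finally show ?thesis .
qed

lemma sq_summable_add:
  assumes "(\<lambda>i. (norm (f i))\<^sup>2) summable_on UNIV" "(\<lambda>i. (norm (g i))\<^sup>2) summable_on UNIV"
  shows "(\<lambda>i. (norm (f i + g i :: 'a::real_normed_vector))\<^sup>2) summable_on UNIV"
  by (rule summable_on_comparison_test[OF summable_on_add[OF
        summable_on_cmult_right[OF assms(1), of 2] summable_on_cmult_right[OF assms(2), of 2]]])
     (auto simp: sq_norm_add_le)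

lemma sq_summable_scale:
  assumes "(\<lambda>i. (norm (f i))\<^sup>2) summable_on UNIV" "\<And>i. norm (g i) \<le> c * norm (f i)"
  shows "(\<lambda>i. (norm (g i :: 'a::real_normed_vector))\<^sup>2) summable_on UNIV"
proof (rule summable_on_comparison_test[OF summable_on_cmult_right[OF assms(1), of "c\<^sup>2"]])
  show "(norm (g i))\<^sup>2 \<le> c\<^sup>2 * (norm (f i))\<^sup>2" for i
    using power_mono[OF assms(2)[of i], of 2] by (simp add: power_mult_distrib)
qed simp

lemma cinner_summable:
  fixes f g :: "'i \<Rightarrow> 'a::complex_inner"
  assumes "(\<lambda>i. (norm (f i))\<^sup>2) summable_on UNIV" "(\<lambda>i. (norm (g i))\<^sup>2) summable_on UNIV"
  shows "(\<lambda>i. cinner (f i) (g i)) summable_on UNIV"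
proof (rule abs_summable_summable,
    rule summable_on_comparison_test[OF summable_on_add[OF assms]])
  show "cmod (cinner (f i) (g i)) \<le> (norm (f i))\<^sup>2 + (norm (g i))\<^sup>2" for i
  proof -
    have "2 * norm (f i) * norm (g i) \<le> (norm (f i))\<^sup>2 + (norm (g i))\<^sup>2"
      by (rule sum_squares_bound)
    moreover have "0 \<le> norm (f i) * norm (g i)" by simp
    ultimately show ?thesis
      using cmod_cinner_le[of "f i" "g i"] by linarith
  qed
qed simp

instantiation l2 :: (type, complex_inner) complex_inner
begin

lift_definition zero_l2 :: "('a, 'b) l2" is "\<lambda>_. 0" by simp
lift_definition plus_l2 :: "('a, 'b) l2 \<Rightarrow> ('a, 'b) l2 \<Rightarrow> ('a, 'b) l2"
  is "\<lambda>f g i. f i + g i" by (rule sq_summable_add)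
lift_definition uminus_l2 :: "('a, 'b) l2 \<Rightarrow> ('a, 'b) l2" is "\<lambda>f i. - f i" by simp
lift_definition minus_l2 :: "('a, 'b) l2 \<Rightarrow> ('a, 'b) l2 \<Rightarrow> ('a, 'b) l2"
  is "\<lambda>f g i. f i - g i"
  using sq_summable_add[of _ "\<lambda>i. - _ i"] by simp
lift_definition scaleR_l2 :: "real \<Rightarrow> ('a, 'b) l2 \<Rightarrow> ('a, 'b) l2" is "\<lambda>r f i. r *\<^sub>R f i"
  by (rule sq_summable_scale) auto
lift_definition scaleC_l2 :: "complex \<Rightarrow> ('a, 'b) l2 \<Rightarrow> ('a, 'b) l2" is "\<lambda>c f i. c *\<^sub>C f i"
  by (rule sq_summable_scale) (auto simp: norm_scaleC)
lift_definition cinner_l2 :: "('a, 'b) l2 \<Rightarrow> ('a, 'b) l2 \<Rightarrow> complex"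
  is "\<lambda>f g. \<Sum>\<^sub>\<infinity>i. cinner (f i) (g i)" .
lift_definition inner_l2 :: "('a, 'b) l2 \<Rightarrow> ('a, 'b) l2 \<Rightarrow> real"
  is "\<lambda>f g. \<Sum>\<^sub>\<infinity>i. inner (f i) (g i)" .

definition norm_l2 :: "('a, 'b) l2 \<Rightarrow> real" where "norm_l2 f = sqrt (inner f f)"
definition dist_l2 :: "('a, 'b) l2 \<Rightarrow> ('a, 'b) l2 \<Rightarrow> real" where "dist_l2 f g = norm (f - g)"
definition sgn_l2 :: "('a, 'b) l2 \<Rightarrow> ('a, 'b) l2" where "sgn_l2 f = scaleR (inverse (norm f)) f"
definition uniformity_l2 :: "(('a, 'b) l2 \<times> ('a, 'b) l2) filter"
  where "uniformity_l2 = (INF e\<in>{0<..}. principal {(x, y). dist x y < e})"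
definition open_l2 :: "('a, 'b) l2 set \<Rightarrow> bool"
  where "open_l2 U \<longleftrightarrow> (\<forall>x\<in>U. \<forall>\<^sub>F (x', y) in uniformity. x' = x \<longrightarrow> y \<in> U)"

instance
proof
  fix f g h :: "('a, 'b) l2" and r s :: real and a b :: complex
  have isum: "(\<lambda>i. inner (u i) (v i)) summable_on UNIV"
    if "(\<lambda>i. (norm (u i))\<^sup>2) summable_on UNIV" "(\<lambda>i. (norm (v i))\<^sup>2) summable_on UNIV"
    for u v :: "'a \<Rightarrow> 'b"
    using summable_on_Re[OF cinner_summable[OF that]] by (simp add: Re_cinner)
  show "f + g + h = f + (g + h)" by transfer (simp add: add.assoc)
  show "f + g = g + f" by transfer (simp add: add.commute)
  show "0 + f = f" by transfer simp
  show "- f + f = 0" by transfer simp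
  show "f - g = f + - g" by transfer simp
  show "r *\<^sub>R (f + g) = r *\<^sub>R f + r *\<^sub>R g" by transfer (simp add: scaleR_add_right)
  show "(r + s) *\<^sub>R f = r *\<^sub>R f + s *\<^sub>R f" by transfer (simp add: scaleR_add_left)
  show "r *\<^sub>R s *\<^sub>R f = (r * s) *\<^sub>R f" by transfer simp
  show "1 *\<^sub>R f = f" by transfer simp
  show "sgn f = scaleR (inverse (norm f)) f" by (fact sgn_l2_def)
  show "dist f g = norm (f - g)" by (fact dist_l2_def)
  show "uniformity = (INF e\<in>{0<..}. principal {(x, y :: ('a, 'b) l2). dist x y < e})"
    by (fact uniformity_l2_def)
  show "open U \<longleftrightarrow> (\<forall>x\<in>U. \<forall>\<^sub>F (x', y) in uniformity. x' = x \<longrightarrow> y \<in> U)"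
    for U :: "('a, 'b) l2 set" by (fact open_l2_def)
  show "inner f g = inner g f" by transfer (simp add: inner_commute)
  show "inner (f + g) h = inner f h + inner g h"
    by transfer (simp add: inner_add_left infsum_add isum)
  show "inner (r *\<^sub>R f) g = r * inner f g"
    by transfer (simp add: infsum_cmult_right')
  show "0 \<le> inner f f" by transfer (simp add: infsum_nonneg)
  show "inner f f = 0 \<longleftrightarrow> f = 0"
  proof transfer
    fix f :: "'a \<Rightarrow> 'b"
    assume f: "(\<lambda>i. (norm (f i))\<^sup>2) summable_on UNIV"
    show "(\<Sum>\<^sub>\<infinity>i. inner (f i) (f i)) = 0 \<longleftrightarrow> f = (\<lambda>_. 0)"
    proof
      assume "(\<Sum>\<^sub>\<infinity>i. inner (f i) (f i)) = 0"
      then have "inner (f i) (f i) = 0" for i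
        using nonneg_infsum_le_0D[of "\<lambda>i. inner (f i) (f i)" UNIV i] isum[OF f f] by auto
      then show "f = (\<lambda>_. 0)" by auto
    qed simp
  qed
  show "norm f = sqrt (inner f f)" by (fact norm_l2_def)
  show "a *\<^sub>C (f + g) = a *\<^sub>C f + a *\<^sub>C g" by transfer (simp add: scaleC_add_right)
  show "(a + b) *\<^sub>C f = a *\<^sub>C f + b *\<^sub>C f" by transfer (simp add: scaleC_add_left)
  show "a *\<^sub>C b *\<^sub>C f = (a * b) *\<^sub>C f" by transfer (simp add: scaleC_scaleC)
  show "complex_of_real r *\<^sub>C f = r *\<^sub>R f" by transfer (simp add: scaleC_of_real)
  show "cinner f g = cnj (cinner g f)"
    by transfer (simp add: infsum_cnj[symmetric] cinner_commute[symmetric] del: infsum_cnj)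
  show "cinner (f + g) h = cinner f h + cinner g h"
    by transfer (simp add: cinner_add_left infsum_add cinner_summable)
  show "cinner (a *\<^sub>C f) g = a * cinner f g"
    by transfer (simp add: cinner_scaleC_left infsum_cmult_right')
  show "Re (cinner f g) = inner f g"
    by transfer (simp add: infsum_Re[symmetric] cinner_summable Re_cinner)
qed

end

lemma norm_l2_sq: "(norm f)\<^sup>2 = (\<Sum>\<^sub>\<infinity>i. (norm (Rep_l2 f i))\<^sup>2)"
  by (simp add: power2_norm_eq_inner inner_l2.rep_eq)

lemma sum_le_norm_l2_sq: "finite F \<Longrightarrow> (\<Sum>i\<in>F. (norm (Rep_l2 f i))\<^sup>2) \<le> (norm f)\<^sup>2"
  unfolding norm_l2_sq using Rep_l2[of f] by (intro finite_sum_le_infsum) auto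

lemma norm_Rep_l2_le: "norm (Rep_l2 f i) \<le> norm f"
  using sum_le_norm_l2_sq[of "{i}" f] by (simp add: power2_le_iff_abs_le)

instance l2 :: (type, chilbert_space) chilbert_space
proof
  fix X :: "nat \<Rightarrow> ('a, 'b) l2"
  assume X: "Cauchy X"
  have "Cauchy (\<lambda>n. Rep_l2 (X n) i)" for i
  proof (rule CauchyI)
    fix e :: real assume "e > 0"
    then obtain M where M: "\<And>m n. m \<ge> M \<Longrightarrow> n \<ge> M \<Longrightarrow> norm (X m - X n) < e"
      using CauchyD[OF X] by metis
    have "norm (Rep_l2 (X m) i - Rep_l2 (X n) i) < e" if "m \<ge> M" "n \<ge> M" for m n
      using norm_Rep_l2_le[of "X m - X n" i] M[OF that] by (simp add: minus_l2.rep_eq)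
    then show "\<exists>M. \<forall>m\<ge>M. \<forall>n\<ge>M. norm (Rep_l2 (X m) i - Rep_l2 (X n) i) < e"
      by blast
  qed
  then have "\<exists>l. (\<lambda>n. Rep_l2 (X n) i) \<longlonglongrightarrow> l" for i
    using Cauchy_convergent convergent_def by blast
  then obtain g where g: "\<And>i. (\<lambda>n. Rep_l2 (X n) i) \<longlonglongrightarrow> g i"
    by metis
  have bound: "(\<Sum>i\<in>F. (norm (Rep_l2 (X m) i - g i))\<^sup>2) \<le> e\<^sup>2"
    if "finite F" and M: "\<And>n. n \<ge> M \<Longrightarrow> norm (X m - X n) < e" for F M m e
  proof (rule LIMSEQ_le_const2)
    show "(\<lambda>n. \<Sum>i\<in>F. (norm (Rep_l2 (X m) i - Rep_l2 (X n) i))\<^sup>2)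
      \<longlonglongrightarrow> (\<Sum>i\<in>F. (norm (Rep_l2 (X m) i - g i))\<^sup>2)"
      by (intro tendsto_intros g)
    have "(\<Sum>i\<in>F. (norm (Rep_l2 (X m) i - Rep_l2 (X n) i))\<^sup>2) \<le> e\<^sup>2" if "n \<ge> M" for n
    proof -
      have "(\<Sum>i\<in>F. (norm (Rep_l2 (X m) i - Rep_l2 (X n) i))\<^sup>2) \<le> (norm (X m - X n))\<^sup>2"
        using sum_le_norm_l2_sq[OF \<open>finite F\<close>, of "X m - X n"] by (simp add: minus_l2.rep_eq)
      also have "\<dots> \<le> e\<^sup>2"
        using M[OF that] by (intro power_mono) auto
      finally show ?thesis .
    qed
    then show "\<exists>N. \<forall>n\<ge>N. (\<Sum>i\<in>F. (norm (Rep_l2 (X m) i - Rep_l2 (X n) i))\<^sup>2) \<le> e\<^sup>2"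
      by blast
  qed
  have summ: "(\<lambda>i. (norm (Rep_l2 (X m) i - g i))\<^sup>2) summable_on UNIV"
    if "\<And>n. n \<ge> M \<Longrightarrow> norm (X m - X n) < e" for M m e
    using bound[OF _ that] by (intro nonneg_bdd_above_summable_on bdd_aboveI2[of _ _ "e\<^sup>2"]) auto
  obtain M1 where M1: "\<And>m n. m \<ge> M1 \<Longrightarrow> n \<ge> M1 \<Longrightarrow> norm (X m - X n) < 1"
    using CauchyD[OF X, of 1] by (metis zero_less_one)
  have "(\<lambda>i. (norm (g i - Rep_l2 (X M1) i))\<^sup>2) summable_on UNIV"
    using summ[OF M1[OF order_refl]] by (simp add: norm_minus_commute)
  from sq_summable_add[OF this, of "Rep_l2 (X M1)"] Rep_l2[of "X M1"]
  have gs: "(\<lambda>i. (norm (g i))\<^sup>2) summable_on UNIV"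
    by simp
  define G where "G = Abs_l2 g"
  have RG: "Rep_l2 G = g"
    using gs by (simp add: G_def Abs_l2_inverse)
  have "X \<longlonglongrightarrow> G"
  proof (rule LIMSEQ_I)
    fix r :: real assume r: "r > 0"
    then obtain M where M: "\<And>m n. m \<ge> M \<Longrightarrow> n \<ge> M \<Longrightarrow> norm (X m - X n) < r / 2"
      using CauchyD[OF X, of "r / 2"] by (metis half_gt_zero)
    have "norm (X m - G) < r" if m: "m \<ge> M" for m
    proof -
      have "(norm (X m - G))\<^sup>2 = (\<Sum>\<^sub>\<infinity>i. (norm (Rep_l2 (X m) i - g i))\<^sup>2)"
        by (simp add: norm_l2_sq minus_l2.rep_eq RG)
      also have "\<dots> \<le> (r / 2)\<^sup>2"
        using bound[OF _ M[OF m]] by (intro infsum_le_finite_sums summ[OF M[OF m]]) auto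
      finally have "norm (X m - G) \<le> r / 2"
        using r by (simp add: power2_le_iff_abs_le)
      then show ?thesis using r by linarith
    qed
    then show "\<exists>no. \<forall>n\<ge>no. norm (X n - G) < r" by blast
  qed
  then show "convergent X" by (auto simp: convergent_def)
qed

lift_definition l2_tensor :: "'i \<Rightarrow> 'a::complex_inner \<Rightarrow> ('i, 'a) l2"
  is "\<lambda>i h j. if j = i then h else 0"
proof -
  fix i :: 'i and h :: 'a
  show "(\<lambda>j. (norm (if j = i then h else 0))\<^sup>2) summable_on UNIV"
    by (rule finite_nonzero_values_imp_summable_on) (auto intro: finite_subset[of _ "{i}"])
qed


section \<open>Bounded operators, adjoints, unitaries\<close>

definition clinear_on :: "'a::complex_inner set \<Rightarrow> ('a \<Rightarrow> 'b::complex_inner) \<Rightarrow> bool" where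
  "clinear_on A T \<longleftrightarrow>
    (\<forall>x\<in>A. \<forall>y\<in>A. T (x + y) = T x + T y) \<and> (\<forall>c. \<forall>x\<in>A. T (c *\<^sub>C x) = c *\<^sub>C T x)"

definition bounded_clinear :: "('a::complex_inner \<Rightarrow> 'b::complex_inner) \<Rightarrow> bool" where
  "bounded_clinear T \<longleftrightarrow> clinear_on UNIV T \<and> (\<exists>B. \<forall>x. norm (T x) \<le> B * norm x)"

definition cadjoint :: "('a::complex_inner \<Rightarrow> 'b::complex_inner) \<Rightarrow> 'b \<Rightarrow> 'a" where
  "cadjoint T = (SOME S. \<forall>x y. cinner (T x) y = cinner x (S y))"

definition unitary_betw ::
  "'a::complex_inner set \<Rightarrow> 'b::complex_inner set \<Rightarrow> ('a \<Rightarrow> 'b) \<Rightarrow> bool" where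
  "unitary_betw A B U \<longleftrightarrow>
    clinear_on A U \<and> U ` A = B \<and> (\<forall>x\<in>A. \<forall>y\<in>A. cinner (U x) (U y) = cinner x y)"


section \<open>Row isometries\<close>

text \<open>
  A row operator with \<open>m\<close> entries is a function \<open>nat \<Rightarrow> 'a \<Rightarrow> 'a\<close> of which only the arguments
  \<open>1, \<dots>, m\<close> matter. A word of the free semigroup on \<open>m\<close> generators is a list over \<open>{1..m}\<close>.
\<close>

definition row_isometry :: "nat \<Rightarrow> (nat \<Rightarrow> 'a::complex_inner \<Rightarrow> 'a) \<Rightarrow> bool" where
  "row_isometry m V \<longleftrightarrow>
    (\<forall>s\<in>{1..m}. bounded_clinear (V s)) \<and>
    (\<forall>s\<in>{1..m}. \<forall>t\<in>{1..m}. \<forall>x. cadjoint (V s) (V t x) = (if s = t then x else 0))"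

definition word_op :: "(nat \<Rightarrow> 'a \<Rightarrow> 'a) \<Rightarrow> nat list \<Rightarrow> 'a \<Rightarrow> 'a" where
  "word_op V \<alpha> = foldr (\<lambda>s T. V s \<circ> T) \<alpha> id"

definition cuntz :: "nat \<Rightarrow> (nat \<Rightarrow> 'a::complex_inner \<Rightarrow> 'a) \<Rightarrow> bool" where
  "cuntz m V \<longleftrightarrow> (\<forall>x. (\<Sum>s\<in>{1..m}. V s (cadjoint (V s) x)) = x)"

text \<open>
  Closed linear span of a family of subspaces: for pairwise orthogonal closed subspaces this is
  their Hilbert space direct sum.
\<close>

definition closed_sum :: "'i set \<Rightarrow> ('i \<Rightarrow> 'a::complex_inner set) \<Rightarrow> 'a set" where
  "closed_sum I F = closure (cspan (\<Union>i\<in>I. F i))"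

definition orthogonal_sets :: "'a::complex_inner set \<Rightarrow> 'a set \<Rightarrow> bool" where
  "orthogonal_sets A B \<longleftrightarrow> (\<forall>x\<in>A. \<forall>y\<in>B. cinner x y = 0)"

definition pure :: "nat \<Rightarrow> (nat \<Rightarrow> 'a::complex_inner \<Rightarrow> 'a) \<Rightarrow> bool" where
  "pure m V \<longleftrightarrow> (\<exists>M. csubspace M \<and> closed M \<and>
    (\<forall>\<alpha>\<in>lists {1..m}. length \<alpha> \<ge> 1 \<longrightarrow> orthogonal_sets M (word_op V \<alpha> ` M)) \<and>
    (\<forall>\<alpha>\<in>lists {1..m}. \<forall>\<beta>\<in>lists {1..m}. \<alpha> \<noteq> \<beta> \<longrightarrow>
      orthogonal_sets (word_op V \<alpha> ` M) (word_op V \<beta> ` M)) \<and>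
    closed_sum (lists {1..m}) (\<lambda>\<alpha>. word_op V \<alpha> ` M) = UNIV)"

text \<open>\<open>lam i j s t\<close> is the \<open>(s, t)\<close> entry of \<open>\<Lambda>\<^sub>i\<^sub>,\<^sub>j\<close>, for \<open>i \<noteq> j\<close>.\<close>

definition twist_matrices ::
  "nat \<Rightarrow> (nat \<Rightarrow> nat) \<Rightarrow> (nat \<Rightarrow> nat \<Rightarrow> nat \<Rightarrow> nat \<Rightarrow> complex) \<Rightarrow> bool" where
  "twist_matrices k n lam \<longleftrightarrow>
    (\<forall>i\<in>{1..k}. \<forall>j\<in>{1..k}. i \<noteq> j \<longrightarrow>
      (\<forall>s\<in>{1..n i}. \<forall>t\<in>{1..n j}.
        cmod (lam i j s t) = 1 \<and> lam j i t s = cnj (lam i j s t)))"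

definition doubly_commuting ::
  "nat \<Rightarrow> (nat \<Rightarrow> nat) \<Rightarrow> (nat \<Rightarrow> nat \<Rightarrow> nat \<Rightarrow> nat \<Rightarrow> complex) \<Rightarrow>
   (nat \<Rightarrow> nat \<Rightarrow> 'a::complex_inner \<Rightarrow> 'a) \<Rightarrow> bool" where
  "doubly_commuting k n lam V \<longleftrightarrow>
    (\<forall>i\<in>{1..k}. \<forall>j\<in>{1..k}. i \<noteq> j \<longrightarrow>
      (\<forall>s\<in>{1..n i}. \<forall>t\<in>{1..n j}. \<forall>x.
        cadjoint (V i s) (V j t x) = cnj (lam i j s t) *\<^sub>C V j t (cadjoint (V i s) x)))"

definition unitarily_equivalent ::
  "nat \<Rightarrow> (nat \<Rightarrow> nat) \<Rightarrow>
   'a::complex_inner set \<Rightarrow> (nat \<Rightarrow> nat \<Rightarrow> 'a \<Rightarrow> 'a) \<Rightarrow>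
   'b::complex_inner set \<Rightarrow> (nat \<Rightarrow> nat \<Rightarrow> 'b \<Rightarrow> 'b) \<Rightarrow> bool" where
  "unitarily_equivalent k n A V B V' \<longleftrightarrow>
    (\<exists>U. unitary_betw A B U \<and>
      (\<forall>i\<in>{1..k}. \<forall>s\<in>{1..n i}. \<forall>x\<in>A. U (V i s x) = V' i s (U x)))"


section \<open>The wandering subspace\<close>

text \<open>
  Tuples of words \<open>(\<alpha>\<^sub>j)\<^sub>j\<^sub>\<in>\<^sub>J\<close>, padded with the empty word outside \<open>J\<close> so that they are
  determined by their entries in \<open>J\<close>.
\<close>

definition multi_words :: "(nat \<Rightarrow> nat) \<Rightarrow> nat set \<Rightarrow> (nat \<Rightarrow> nat list) set" where
  "multi_words n J = {\<alpha>. (\<forall>j\<in>J. \<alpha> j \<in> lists {1..n j}) \<and> (\<forall>j. j \<notin> J \<longrightarrow> \<alpha> j = [])}"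

text \<open>The product \<open>V\<^bsub>p+1,\<alpha>(p+1)\<^esub> \<cdots> V\<^bsub>k,\<alpha>(k)\<^esub>\<close>, which is the identity for \<open>p = k\<close>.\<close>

definition multi_word_op ::
  "nat \<Rightarrow> nat \<Rightarrow> (nat \<Rightarrow> nat \<Rightarrow> 'a \<Rightarrow> 'a) \<Rightarrow> (nat \<Rightarrow> nat list) \<Rightarrow> 'a \<Rightarrow> 'a" where
  "multi_word_op k p V \<alpha> = foldr (\<lambda>j T. word_op (V j) (\<alpha> j) \<circ> T) [p+1..<k+1] id"

definition kernel_meet ::
  "(nat \<Rightarrow> nat) \<Rightarrow> nat \<Rightarrow> (nat \<Rightarrow> nat \<Rightarrow> 'a::complex_inner \<Rightarrow> 'a) \<Rightarrow> 'a set" where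
  "kernel_meet n p V = {x. \<forall>i\<in>{1..p}. \<forall>s\<in>{1..n i}. cadjoint (V i s) x = 0}"

text \<open>
  The nested direct sum over \<open>|\<alpha>\<^sub>j| = m\<^sub>j\<close>, \<open>p < j \<le> k\<close>, is taken over the tuples
  \<open>(\<alpha>\<^sub>p\<^sub>+\<^sub>1, \<dots>, \<alpha>\<^sub>k)\<close>. For \<open>p = k\<close> the only tuple is the empty one.
\<close>

definition wandering_subspace ::
  "nat \<Rightarrow> (nat \<Rightarrow> nat) \<Rightarrow> nat \<Rightarrow> (nat \<Rightarrow> nat \<Rightarrow> 'a::complex_inner \<Rightarrow> 'a) \<Rightarrow> 'a set" where
  "wandering_subspace k n p V =
    (\<Inter>m :: nat \<Rightarrow> nat.
      closed_sum {\<alpha> \<in> multi_words n {p+1..k}. \<forall>j\<in>{p+1..k}. length (\<alpha> j) = m j}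
        (\<lambda>\<alpha>. multi_word_op k p V \<alpha> ` kernel_meet n p V))"


section \<open>Standard tuples\<close>

type_synonym 'a fock = "(nat \<Rightarrow> nat list, 'a) l2"

definition lam_word ::
  "(nat \<Rightarrow> nat \<Rightarrow> nat \<Rightarrow> nat \<Rightarrow> complex) \<Rightarrow> nat \<Rightarrow> nat \<Rightarrow> nat \<Rightarrow> nat list \<Rightarrow> complex" where
  "lam_word lam i j s \<beta> = (\<Prod>b\<leftarrow>\<beta>. lam i j s b)"

definition fock_space ::
  "(nat \<Rightarrow> nat) \<Rightarrow> nat \<Rightarrow> 'a::complex_inner set \<Rightarrow> 'a fock set" where
  "fock_space n p L =
    {f. \<forall>\<alpha>. if \<alpha> \<in> multi_words n {1..p} then Rep_l2 f \<alpha> \<in> L else Rep_l2 f \<alpha> = 0}"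

text \<open>
  The operators are given by their action on functions; \<open>std_S_tensor\<close> and \<open>std_W_tensor\<close>
  below are the formulas on elementary tensors. In \<open>std_S\<close>, the coefficient at \<open>\<gamma>\<close> comes from the
  unique \<open>\<alpha>\<close> with \<open>\<gamma> = (\<alpha>\<^sub>1, \<dots>, g\<^sub>s \<alpha>\<^sub>i, \<dots>, \<alpha>\<^sub>p)\<close>, if there is one, and the scalar depends only
  on \<open>\<alpha>\<^sub>j = \<gamma>\<^sub>j\<close> for \<open>j < i\<close>.
\<close>

definition std_S ::
  "(nat \<Rightarrow> nat \<Rightarrow> nat \<Rightarrow> nat \<Rightarrow> complex) \<Rightarrow> nat \<Rightarrow> nat \<Rightarrow> 'a::complex_inner fock \<Rightarrow> 'a fock" where
  "std_S lam i s f = Abs_l2 (\<lambda>\<gamma>.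
    if \<gamma> i \<noteq> [] \<and> hd (\<gamma> i) = s
    then (\<Prod>j\<in>{1..<i}. lam_word lam i j s (\<gamma> j)) *\<^sub>C Rep_l2 f (\<gamma>(i := tl (\<gamma> i)))
    else 0)"

definition std_W ::
  "(nat \<Rightarrow> nat \<Rightarrow> nat \<Rightarrow> nat \<Rightarrow> complex) \<Rightarrow> nat \<Rightarrow> (nat \<Rightarrow> nat \<Rightarrow> 'a \<Rightarrow> 'a) \<Rightarrow>
   nat \<Rightarrow> nat \<Rightarrow> 'a::complex_inner fock \<Rightarrow> 'a fock" where
  "std_W lam p Wt i s f = Abs_l2 (\<lambda>\<alpha>.
    (\<Prod>j\<in>{1..p}. lam_word lam i j s (\<alpha> j)) *\<^sub>C Wt i s (Rep_l2 f \<alpha>))"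

definition std_tuple ::
  "(nat \<Rightarrow> nat \<Rightarrow> nat \<Rightarrow> nat \<Rightarrow> complex) \<Rightarrow> nat \<Rightarrow> (nat \<Rightarrow> nat \<Rightarrow> 'a \<Rightarrow> 'a) \<Rightarrow>
   nat \<Rightarrow> nat \<Rightarrow> 'a::complex_inner fock \<Rightarrow> 'a fock" where
  "std_tuple lam p Wt i s = (if i \<le> p then std_S lam i s else std_W lam p Wt i s)"

lemma std_S_tensor:
  "std_S lam i s (l2_tensor \<alpha> h) =
    (\<Prod>j\<in>{1..<i}. lam_word lam i j s (\<alpha> j)) *\<^sub>C l2_tensor (\<alpha>(i := s # \<alpha> i)) h"
proof -
  have "(\<lambda>\<gamma>. if \<gamma> i \<noteq> [] \<and> hd (\<gamma> i) = s
      then (\<Prod>j\<in>{1..<i}. lam_word lam i j s (\<gamma> j)) *\<^sub>C Rep_l2 (l2_tensor \<alpha> h) (\<gamma>(i := tl (\<gamma> i)))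
      else 0) =
    Rep_l2 ((\<Prod>j\<in>{1..<i}. lam_word lam i j s (\<alpha> j)) *\<^sub>C l2_tensor (\<alpha>(i := s # \<alpha> i)) h)"
    (is "?l = ?r")
  proof
    fix \<gamma>
    have "(\<gamma> i \<noteq> [] \<and> hd (\<gamma> i) = s \<and> \<gamma>(i := tl (\<gamma> i)) = \<alpha>) \<longleftrightarrow> \<gamma> = \<alpha>(i := s # \<alpha> i)"
      by (cases "\<gamma> i") (auto simp: fun_upd_idem)
    moreover have "(\<Prod>j\<in>{1..<i}. lam_word lam i j s ((\<alpha>(i := s # \<alpha> i)) j)) =
        (\<Prod>j\<in>{1..<i}. lam_word lam i j s (\<alpha> j))"
      by (rule prod.cong) auto
    ultimately show "?l \<gamma> = ?r \<gamma>"
      by (cases "\<gamma> = \<alpha>(i := s # \<alpha> i)") (auto simp: l2_tensor.rep_eq scaleC_l2.rep_eq)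
  qed
  then show ?thesis
    by (simp add: std_S_def Rep_l2_inverse)
qed

lemma std_W_tensor:
  assumes "Wt i s 0 = 0"
  shows "std_W lam p Wt i s (l2_tensor \<alpha> h) =
    (\<Prod>j\<in>{1..p}. lam_word lam i j s (\<alpha> j)) *\<^sub>C l2_tensor \<alpha> (Wt i s h)"
proof -
  have "(\<lambda>\<gamma>. (\<Prod>j\<in>{1..p}. lam_word lam i j s (\<gamma> j)) *\<^sub>C Wt i s (Rep_l2 (l2_tensor \<alpha> h) \<gamma>)) =
    Rep_l2 ((\<Prod>j\<in>{1..p}. lam_word lam i j s (\<alpha> j)) *\<^sub>C l2_tensor \<alpha> (Wt i s h))"
    by (auto simp: fun_eq_iff l2_tensor.rep_eq scaleC_l2.rep_eq assms)
  then show ?thesis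
    by (simp add: std_W_def Rep_l2_inverse)
qed

text \<open>On the standard space the functions above are square-summable.\<close>

lemma cmod_lam_word:
  assumes "twist_matrices k n lam" "i \<in> {1..k}" "j \<in> {1..k}" "i \<noteq> j" "s \<in> {1..n i}"
    and "\<beta> \<in> lists {1..n j}"
  shows "cmod (lam_word lam i j s \<beta>) = 1"
  using assms(6)
proof (induction \<beta>)
  case (Cons b \<beta>)
  moreover have "cmod (lam i j s b) = 1"
    using assms(1)[unfolded twist_matrices_def, rule_format, OF assms(2,3,4,5) Cons.hyps(1)]
    by simp
  ultimately show ?case by (simp add: lam_word_def norm_mult)
qed (simp add: lam_word_def)

lemma cmod_lam_prod:
  assumes "twist_matrices k n lam" "i \<in> {1..k}" "s \<in> {1..n i}" "J \<subseteq> {1..k}" "i \<notin> J"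
    and "\<And>j. j \<in> J \<Longrightarrow> \<alpha> j \<in> lists {1..n j}"
  shows "cmod (\<Prod>j\<in>J. lam_word lam i j s (\<alpha> j)) = 1"
proof -
  have "(\<Prod>j\<in>J. cmod (lam_word lam i j s (\<alpha> j))) = 1"
    using assms(4,5,6) by (intro prod.neutral ballI cmod_lam_word[OF assms(1,2) _ _ assms(3)]) auto
  then show ?thesis by (simp only: prod_norm)
qed

lemma Rep_std_S:
  assumes "twist_matrices k n lam" "p \<le> k" "i \<in> {1..p}" "s \<in> {1..n i}" "f \<in> fock_space n p L"
  shows "Rep_l2 (std_S lam i s f) \<gamma> =
    (if \<gamma> i \<noteq> [] \<and> hd (\<gamma> i) = s
     then (\<Prod>j\<in>{1..<i}. lam_word lam i j s (\<gamma> j)) *\<^sub>C Rep_l2 f (\<gamma>(i := tl (\<gamma> i)))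
     else 0)"
proof -
  define C where "C = {\<gamma> :: nat \<Rightarrow> nat list. \<gamma> i \<noteq> [] \<and> hd (\<gamma> i) = s}"
  define \<phi> where "\<phi> = (\<lambda>\<gamma> :: nat \<Rightarrow> nat list. \<gamma>(i := tl (\<gamma> i)))"
  define c where "c = (\<lambda>\<gamma> :: nat \<Rightarrow> nat list. \<Prod>j\<in>{1..<i}. lam_word lam i j s (\<gamma> j))"
  have inj: "inj_on \<phi> C"
  proof (rule inj_onI, rule ext)
    fix x y j assume x: "x \<in> C" and y: "y \<in> C" and eq: "\<phi> x = \<phi> y"
    show "x j = y j"
    proof (cases "j = i")
      case True
      have "tl (x i) = tl (y i)" using fun_cong[OF eq, of i] by (simp add: \<phi>_def)
      then show ?thesis using x y True unfolding C_def by (metis (mono_tags) list.collapse mem_Collect_eq)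
    next
      case False
      then show ?thesis using fun_cong[OF eq, of j] by (simp add: \<phi>_def)
    qed
  qed
  have "(\<lambda>\<alpha>. (norm (Rep_l2 f \<alpha>))\<^sup>2) summable_on \<phi> ` C"
    by (rule summable_on_subset_banach[of _ UNIV]) (use Rep_l2[of f] in auto)
  then have sC: "(\<lambda>\<gamma>. (norm (Rep_l2 f (\<phi> \<gamma>)))\<^sup>2) summable_on C"
    by (simp add: summable_on_reindex[OF inj] o_def)
  have nc: "norm (c \<gamma> *\<^sub>C Rep_l2 f (\<phi> \<gamma>)) = norm (Rep_l2 f (\<phi> \<gamma>))" for \<gamma>
  proof (cases "\<phi> \<gamma> \<in> multi_words n {1..p}")
    case True
    have "\<gamma> j \<in> lists {1..n j}" if "j \<in> {1..<i}" for j
    proof -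
      have "\<phi> \<gamma> j \<in> lists {1..n j}"
        using True assms(3) that unfolding multi_words_def by auto
      then show ?thesis using that by (simp add: \<phi>_def)
    qed
    then have "cmod (c \<gamma>) = 1"
      unfolding c_def using assms(2,3) by (intro cmod_lam_prod[OF assms(1) _ assms(4)]) auto
    then show ?thesis by (simp add: norm_scaleC)
  next
    case False
    then have "Rep_l2 f (\<phi> \<gamma>) = 0"
      using assms(5) unfolding fock_space_def by (simp split: if_splits)
    then show ?thesis by simp
  qed
  have "(\<lambda>\<gamma>. (norm (if \<gamma> \<in> C then c \<gamma> *\<^sub>C Rep_l2 f (\<phi> \<gamma>) else 0))\<^sup>2) summable_on UNIV"
    by (rule iffD1[OF summable_on_cong_neutral sC]) (simp_all add: nc)
  then have "Rep_l2 (Abs_l2 (\<lambda>\<gamma>. if \<gamma> \<in> C then c \<gamma> *\<^sub>C Rep_l2 f (\<phi> \<gamma>) else 0)) =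
      (\<lambda>\<gamma>. if \<gamma> \<in> C then c \<gamma> *\<^sub>C Rep_l2 f (\<phi> \<gamma>) else 0)"
    by (intro Abs_l2_inverse) simp
  from fun_cong[OF this, of \<gamma>] show ?thesis
    unfolding std_S_def C_def c_def \<phi>_def mem_Collect_eq .
qed

lemma Rep_std_W:
  assumes "twist_matrices k n lam" "i \<in> {p+1..k}" "s \<in> {1..n i}" "f \<in> fock_space n p L"
    and "Wt i s 0 = 0" "\<And>x. x \<in> L \<Longrightarrow> norm (Wt i s x) \<le> B * norm x"
  shows "Rep_l2 (std_W lam p Wt i s f) \<alpha> =
    (\<Prod>j\<in>{1..p}. lam_word lam i j s (\<alpha> j)) *\<^sub>C Wt i s (Rep_l2 f \<alpha>)"
proof -
  have "norm ((\<Prod>j\<in>{1..p}. lam_word lam i j s (\<alpha> j)) *\<^sub>C Wt i s (Rep_l2 f \<alpha>))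
      \<le> B * norm (Rep_l2 f \<alpha>)" for \<alpha>
  proof (cases "\<alpha> \<in> multi_words n {1..p}")
    case True
    then have "cmod (\<Prod>j\<in>{1..p}. lam_word lam i j s (\<alpha> j)) = 1"
      using assms(2) by (intro cmod_lam_prod[OF assms(1) _ assms(3)]) (auto simp: multi_words_def)
    moreover have "Rep_l2 f \<alpha> \<in> L"
      using True assms(4) unfolding fock_space_def by (simp split: if_splits)
    ultimately show ?thesis by (simp add: norm_scaleC assms(6))
  next
    case False
    then have "Rep_l2 f \<alpha> = 0"
      using assms(4) unfolding fock_space_def by (simp split: if_splits)
    then show ?thesis by (simp add: assms(5))
  qed
  then have "(\<lambda>\<alpha>. (norm ((\<Prod>j\<in>{1..p}. lam_word lam i j s (\<alpha> j)) *\<^sub>C Wt i s (Rep_l2 f \<alpha>)))\<^sup>2)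
      summable_on UNIV"
    by (rule sq_summable_scale[of "Rep_l2 f" _ B, rotated]) (use Rep_l2[of f] in auto)
  then show ?thesis
    by (simp add: std_W_def Abs_l2_inverse)
qed

end

theory Submission
  imports Defs
begin

text \<open>
  For a pure row isometry the intersection of the kernels of the \<open>V\<^sub>s\<^sup>*\<close> generates the whole space,
  and this remains true inside every closed reducing subspace. As the joint kernel of
  \<open>V\<^sub>1, \<dots>, V\<^sub>q\<close> reduces \<open>V\<^sub>q\<^sub>+\<^sub>1\<close>, an induction on \<open>q\<close> shows that the images
  \<open>V\<^bsub>1,\<alpha>(1)\<^esub> \<cdots> V\<^bsub>p,\<alpha>(p)\<^esub> L\<close> of the joint kernel \<open>L\<close> of \<open>V\<^sub>1, \<dots>, V\<^sub>p\<close> decompose the space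
  orthogonally. The Cuntz relations identify \<open>L\<close> with the wandering subspace. The unitary sends
  \<open>V\<^bsub>1,\<alpha>(1)\<^esub> \<cdots> V\<^bsub>p,\<alpha>(p)\<^esub> h\<close> to \<open>\<chi>\<^sub>\<alpha> \<otimes> h\<close>; it intertwines the tuples because double commutation implies
  \<open>V\<^bsub>i,s\<^esub> V\<^bsub>j,t\<^esub> = \<lambda>\<^bsub>i,j\<^esub>(s,t) V\<^bsub>j,t\<^esub> V\<^bsub>i,s\<^esub>\<close>.
\<close>

section \<open>Bounded operators on complex Hilbert spaces\<close>

lemma cinner_add_right: "cinner x (y + z) = cinner x y + cinner x z"
  by (metis cinner_add_left cinner_commute complex_cnj_add)

lemma cinner_scaleC_right: "cinner x (a *\<^sub>C y) = cnj a * cinner x y"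
  by (metis cinner_commute cinner_scaleC_left complex_cnj_mult)

lemma cinner_zero_left [simp]: "cinner 0 y = 0"
  using cinner_add_left[of 0 0 y] by simp

lemma cinner_zero_right [simp]: "cinner x 0 = 0"
  using cinner_add_right[of x 0 0] by simp

lemma cinner_diff_left: "cinner (x - y) z = cinner x z - cinner y z"
  using cinner_add_left[of "x - y" y z] by simp

lemma cinner_diff_right: "cinner x (y - z) = cinner x y - cinner x z"
  using cinner_add_right[of x "y - z" z] by simp

lemma cinner_sum_left: "cinner (sum f F) y = (\<Sum>i\<in>F. cinner (f i) y)"
  by (induction F rule: infinite_finite_induct) (simp_all add: cinner_add_left)

lemma cinner_sum_right: "cinner x (sum f F) = (\<Sum>i\<in>F. cinner x (f i))"
  by (induction F rule: infinite_finite_induct) (simp_all add: cinner_add_right)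

lemma cinner_eq_zero_iff [simp]: "cinner x x = 0 \<longleftrightarrow> x = 0"
  by (simp add: cinner_self)

lemma cinner_swap_zero: "cinner x y = 0 \<Longrightarrow> cinner y x = 0"
  by (metis cinner_commute complex_cnj_zero)

text \<open>The difference \<open>x - y\<close> lies in \<open>M\<close> itself, so it may be used
  as a test vector. With \<open>M = UNIV\<close> this identifies adjoints, with smaller
  \<open>M\<close> compressions to a subspace.\<close>

lemma cinner_ext:
  assumes "csubspace M" "x \<in> M" "y \<in> M" "\<And>h. h \<in> M \<Longrightarrow> cinner h x = cinner h y"
  shows "x = y"
proof -
  have "cinner (x - y) (x - y) = 0"
    using assms(4)[OF complex_vector.subspace_diff[OF assms(1-3)]] by (simp add: cinner_diff_right)
  then show ?thesis by simp
qed

text \<open>Conjugate linearity in the second argument is still real linearity, which is enough to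
  obtain continuity.\<close>

lemma bounded_linear_cinner_right: "bounded_linear (cinner x)"
proof (rule bounded_linear_intro)
  show "cinner x (r *\<^sub>R y) = r *\<^sub>R cinner x y" for r y
    by (simp add: scaleC_of_real[symmetric] cinner_scaleC_right scaleR_conv_of_real)
  show "norm (cinner x y) \<le> norm y * norm x" for y
    using cmod_cinner_le[of x y] by (simp add: mult.commute)
qed (simp add: cinner_add_right)

section \<open>Bounded complex-linear maps and their compositions\<close>

lemma bounded_clinearI:
  assumes "\<And>x y. T (x + y) = T x + T y" "\<And>c x. T (c *\<^sub>C x) = c *\<^sub>C T x"
    "\<And>x. norm (T x) \<le> B * norm x"
  shows "bounded_clinear T"
  using assms by (auto simp: bounded_clinear_def clinear_on_def)

text \<open>The definition admits a negative bound on a zero space; the absolute value makes bounds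
  safe to multiply.\<close>

lemma bounded_clinear_bound:
  assumes "bounded_clinear T"
  obtains B where "B \<ge> 0" "\<And>x. norm (T x) \<le> B * norm x"
proof -
  obtain B where B: "\<And>x. norm (T x) \<le> B * norm x"
    using assms by (auto simp: bounded_clinear_def)
  have "norm (T x) \<le> \<bar>B\<bar> * norm x" for x
    by (rule order_trans[OF B]) (simp add: mult_right_mono)
  then show ?thesis by (intro that[of "\<bar>B\<bar>"]) auto
qed

context
  fixes T :: "'a::complex_inner \<Rightarrow> 'b::complex_inner"
  assumes T: "bounded_clinear T"
begin

lemma bounded_clinear_add: "T (x + y) = T x + T y"
  using T by (simp add: bounded_clinear_def clinear_on_def)

lemma bounded_clinear_scaleC: "T (c *\<^sub>C x) = c *\<^sub>C T x"
  using T by (simp add: bounded_clinear_def clinear_on_def)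

lemma bounded_clinear_zero: "T 0 = 0"
  using bounded_clinear_add[of 0 0] by simp

lemma bounded_clinear_diff: "T (x - y) = T x - T y"
  using bounded_clinear_add[of "x - y" y] by (simp add: algebra_simps)

lemma bounded_clinear_sum: "T (sum f F) = (\<Sum>i\<in>F. T (f i))"
  by (induction F rule: infinite_finite_induct)
     (simp_all add: bounded_clinear_add bounded_clinear_zero)

lemma bounded_clinear_bounded_linear: "bounded_linear T"
proof -
  obtain B where "\<And>x. norm (T x) \<le> B * norm x"
    using bounded_clinear_bound[OF T] by blast
  then show ?thesis
    by (intro bounded_linear_intro[where K = B])
       (simp_all add: bounded_clinear_add bounded_clinear_scaleC mult.commute flip: scaleC_of_real)
qed

lemma csubspace_vimage: "csubspace S \<Longrightarrow> csubspace {x. T x \<in> S}"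
  unfolding complex_vector.subspace_def
  by (simp add: bounded_clinear_add bounded_clinear_scaleC bounded_clinear_zero)

lemma bounded_clinear_span_image:
  assumes "csubspace S" "x \<in> cspan G" "\<And>g. g \<in> G \<Longrightarrow> T g \<in> S"
  shows "T x \<in> S"
  using complex_vector.span_minimal[OF _ csubspace_vimage[OF assms(1)], of G] assms(2,3) by auto

end

lemma bounded_clinear_id: "bounded_clinear (\<lambda>x. x)"
  by (rule bounded_clinearI[where B = 1]) auto

lemma bounded_clinear_scale:
  assumes "bounded_clinear T"
  shows "bounded_clinear (\<lambda>x. c *\<^sub>C T x)"
proof -
  obtain B where B: "\<And>x. norm (T x) \<le> B * norm x"
    using bounded_clinear_bound[OF assms] by blast
  show ?thesis
  proof (rule bounded_clinearI)
    show "norm (c *\<^sub>C T x) \<le> cmod c * B * norm x" for x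
      using B[of x] by (simp add: norm_scaleC mult.assoc mult_left_mono)
  qed (simp_all add: bounded_clinear_add[OF assms] bounded_clinear_scaleC[OF assms]
      scaleC_add_right scaleC_scaleC mult.commute)
qed

lemma bounded_clinear_compose:
  assumes "bounded_clinear S" "bounded_clinear T"
  shows "bounded_clinear (\<lambda>x. S (T x))"
proof -
  obtain B where B: "B \<ge> 0" "\<And>x. norm (S x) \<le> B * norm x"
    using bounded_clinear_bound[OF assms(1)] by blast
  obtain C where C: "\<And>x. norm (T x) \<le> C * norm x"
    using bounded_clinear_bound[OF assms(2)] by blast
  show ?thesis
  proof (rule bounded_clinearI)
    show "norm (S (T x)) \<le> B * C * norm x" for x
      using order_trans[OF B(2) mult_left_mono[OF C B(1)]] by (simp add: mult.assoc)
  qed (simp_all add: bounded_clinear_add[OF assms(1)] bounded_clinear_add[OF assms(2)]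
      bounded_clinear_scaleC[OF assms(1)] bounded_clinear_scaleC[OF assms(2)])
qed

lemma bounded_clinear_foldr:
  assumes "\<And>a. a \<in> set as \<Longrightarrow> bounded_clinear (T a)"
  shows "bounded_clinear (foldr T as)"
  using assms
proof (induction as)
  case (Cons a as)
  then show ?case using bounded_clinear_compose[of "T a" "foldr T as"] by (simp add: o_def)
qed (simp add: bounded_clinear_id id_def)

section \<open>Riesz representation, projections and adjoints\<close>

text \<open>
  The representing vector minimises \<open>\<parallel>x\<parallel>\<^sup>2 - 2 Re (f x)\<close> on \<open>M\<close>; minimising sequences are Cauchy by
  the parallelogram law.
\<close>

lemma riesz_subspace:
  fixes f :: "'a::chilbert_space \<Rightarrow> complex"
  assumes M: "csubspace M" "closed M"
    and f_add: "\<And>x y. f (x + y) = f x + f y" and f_scale: "\<And>c x. f (c *\<^sub>C x) = c * f x"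
    and f_bound: "\<And>x. cmod (f x) \<le> B * norm x"
  obtains z where "z \<in> M" "\<And>x. x \<in> M \<Longrightarrow> f x = cinner x z"
proof -
  define q where "q x = (norm x)\<^sup>2 - 2 * Re (f x)" for x
  have f_scaleR: "f (r *\<^sub>R x) = of_real r * f x" for r x
    by (simp add: f_scale flip: scaleC_of_real)
  have M_scaleR: "r *\<^sub>R x \<in> M" if "x \<in> M" for r x
    using complex_vector.subspace_scale[OF M(1) that, of "of_real r"] by (simp add: scaleC_of_real)
  \<comment> \<open>Completing the square: \<open>q x\<close> is at least
    \<open>(norm x - B)^2 - B^2\<close>.\<close>
  have q_lower: "- B\<^sup>2 \<le> q x" for x
  proof -
    have "Re (f x) \<le> B * norm x"
      using f_bound[of x] complex_Re_le_cmod[of "f x"] by linarith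
    moreover have "0 \<le> (norm x - B)\<^sup>2" by simp
    ultimately show ?thesis
      unfolding q_def by (simp add: power2_diff mult.commute)
  qed
  then have bdd: "bdd_below (q ` M)" by (intro bdd_belowI2)
  define m where "m = (INF x\<in>M. q x)"
  have m_le: "m \<le> q x" if "x \<in> M" for x
    unfolding m_def using bdd that by (rule cINF_lower)
  have "\<exists>x\<in>M. q x < m + 1 / real (Suc i)" for i
    using cINF_less_iff[of M q "m + 1 / real (Suc i)"] bdd complex_vector.subspace_0[OF M(1)]
    unfolding m_def by auto
  then obtain X where X: "\<And>i. X i \<in> M" "\<And>i. q (X i) < m + 1 / real (Suc i)"
    by metis
  \<comment> \<open>The midpoint of \<open>x\<close> and \<open>y\<close> is again in
    \<open>M\<close>, so \<open>m\<close> bounds \<open>q\<close> there from below.\<close>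
  have par: "(norm (x - y))\<^sup>2 \<le> 2 * (q x - m) + 2 * (q y - m)" if "x \<in> M" "y \<in> M" for x y
  proof -
    have "m \<le> q ((1/2) *\<^sub>R (x + y))"
      using that by (intro m_le M_scaleR complex_vector.subspace_add[OF M(1)])
    moreover have "q ((1/2) *\<^sub>R (x + y)) = (norm (x + y))\<^sup>2 / 4 - Re (f x) - Re (f y)"
      unfolding q_def norm_scaleR f_scaleR f_add by (simp add: power_divide field_simps)
    moreover have "(norm (x + y))\<^sup>2 + (norm (x - y))\<^sup>2 = 2 * (norm x)\<^sup>2 + 2 * (norm y)\<^sup>2"
      by (simp add: power2_norm_eq_inner inner_add inner_diff inner_commute)
    ultimately show ?thesis
      by (simp add: q_def)
  qed
  have "Cauchy X"
  proof (rule CauchyI)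
    fix e :: real assume e: "e > 0"
    \<comment> \<open>Two deviations below a quarter of the square of \<open>e\<close> contribute,
      with the factors 2 in \<open>par\<close>, less than that square.\<close>
    obtain N where N: "1 / real (Suc N) < e\<^sup>2 / 4"
      using nat_approx_posE[of "e\<^sup>2 / 4"] e by auto
    have "norm (X i - X j) < e" if "i \<ge> N" "j \<ge> N" for i j
    proof -
      have "q (X l) - m < e\<^sup>2 / 4" if "l \<ge> N" for l
      proof -
        have "1 / real (Suc l) \<le> 1 / real (Suc N)"
          using that by (simp add: frac_le)
        then show ?thesis using X(2)[of l] N by linarith
      qed
      moreover have "c < d" if "a < d / 4" "b < d / 4" "c \<le> 2 * a + 2 * b" for a b c d :: real
        using that by linarith
      ultimately have "(norm (X i - X j))\<^sup>2 < e\<^sup>2"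
        using that par[OF X(1)[of i] X(1)[of j]] by blast
      then show ?thesis using e by (simp add: power_less_imp_less_base)
    qed
    then show "\<exists>M. \<forall>i\<ge>M. \<forall>j\<ge>M. norm (X i - X j) < e" by blast
  qed
  then obtain z where z: "X \<longlonglongrightarrow> z"
    using Cauchy_convergent convergent_def by blast
  have zM: "z \<in> M"
    using closed_sequentially[OF M(2)] X(1) z by blast
  have "bounded_linear f"
    by (rule bounded_linear_intro[where K = B])
       (simp_all add: f_add f_scaleR scaleR_conv_of_real f_bound mult.commute[of _ B])
  then have "(\<lambda>i. f (X i)) \<longlonglongrightarrow> f z"
    by (rule bounded_linear.tendsto) (rule z)
  then have "(\<lambda>i. q (X i)) \<longlonglongrightarrow> q z"
    unfolding q_def by (intro tendsto_intros z)
  moreover have "(\<lambda>i. m + 1 / real (Suc i)) \<longlonglongrightarrow> m + 0"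
    by (intro tendsto_intros LIMSEQ_inverse_real_of_nat[unfolded inverse_eq_divide])
  ultimately have "q z \<le> m + 0"
    by (rule LIMSEQ_le) (intro exI allI impI less_imp_le X(2))
  then have z_min: "q z \<le> q x" if "x \<in> M" for x
    using m_le[OF that] by simp
  have re: "Re (f h) = Re (cinner h z)" if h: "h \<in> M" for h
  proof -
    define a where "a = inner h z - Re (f h)"
    have quad: "0 \<le> t\<^sup>2 * (norm h)\<^sup>2 + 2 * t * a" for t
    proof -
      have "(norm (z + t *\<^sub>R h))\<^sup>2 = (norm z)\<^sup>2 + 2 * t * inner h z + t\<^sup>2 * (norm h)\<^sup>2"
        unfolding power2_norm_eq_inner by (simp add: inner_add inner_commute power2_eq_square)
      then show ?thesis
        using z_min[OF complex_vector.subspace_add[OF M(1) zM M_scaleR[OF h, of t]]]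
        by (simp add: q_def a_def f_scaleR f_add algebra_simps)
    qed
    have "a = 0"
    proof (cases "h = 0")
      case True
      then show ?thesis using f_scale[of 0 h] by (simp add: a_def)
    next
      case False
      \<comment> \<open>The chosen \<open>t\<close> minimises the quadratic polynomial in
        \<open>quad\<close>.\<close>
      then have "(- a / (norm h)\<^sup>2)\<^sup>2 * (norm h)\<^sup>2 + 2 * (- a / (norm h)\<^sup>2) * a
          = - (a\<^sup>2 / (norm h)\<^sup>2)"
        by (simp add: field_simps power2_eq_square)
      with quad[of "- a / (norm h)\<^sup>2"] have "a\<^sup>2 / (norm h)\<^sup>2 \<le> 0" by simp
      with False show ?thesis by (simp add: divide_le_0_iff)
    qed
    then show ?thesis by (simp add: a_def Re_cinner)
  qed
  \<comment> \<open>Replacing \<open>h\<close> by \<open>\<i> *\<^sub>C h\<close> turns the identity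
    of real parts into that of imaginary parts.\<close>
  have "f h = cinner h z" if h: "h \<in> M" for h
    using re[OF h] re[OF complex_vector.subspace_scale[OF M(1) h, of \<i>]]
    by (simp add: f_scale cinner_scaleC_left complex_eq_iff)
  with zM show thesis by (rule that)
qed

text \<open>Riesz representation of \<open>x \<mapsto> cinner (T x) y\<close> on \<open>M\<close>.
  For \<open>M = UNIV\<close> the vector \<open>z\<close> is the adjoint of \<open>T\<close> at
  \<open>y\<close>; for \<open>T\<close> the identity it is the orthogonal projection of
  \<open>y\<close> to \<open>M\<close>.\<close>

lemma adjoint_subspace:
  fixes T :: "'a::chilbert_space \<Rightarrow> 'b::complex_inner"
  assumes "csubspace M" "closed M" "bounded_clinear T"
  obtains z where "z \<in> M" "\<And>x. x \<in> M \<Longrightarrow> cinner (T x) y = cinner x z"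
proof -
  obtain B where B: "\<And>x. norm (T x) \<le> B * norm x"
    using bounded_clinear_bound[OF assms(3)] by blast
  have bound: "cmod (cinner (T x) y) \<le> (B * norm y) * norm x" for x
    using order_trans[OF cmod_cinner_le mult_right_mono[OF B norm_ge_zero]]
    by (simp add: mult.commute mult.left_commute)
  show thesis
    by (rule riesz_subspace[OF assms(1,2), of "\<lambda>x. cinner (T x) y", OF _ _ bound])
       (auto intro: that simp: bounded_clinear_add[OF assms(3)] bounded_clinear_scaleC[OF assms(3)]
         cinner_add_left cinner_scaleC_left)
qed

text \<open>\<open>cadjoint\<close> is an arbitrary choice; Riesz representation supplies the
  existence that makes the choice meaningful.\<close>

lemma cinner_cadjoint:
  fixes T :: "'a::chilbert_space \<Rightarrow> 'b::complex_inner"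
  assumes "bounded_clinear T"
  shows "cinner (T x) y = cinner x (cadjoint T y)"
proof -
  have "\<exists>z. \<forall>x. cinner (T x) y = cinner x z" for y
    by (rule adjoint_subspace[OF complex_vector.subspace_UNIV closed_UNIV assms, of y]) blast
  then have "\<exists>S. \<forall>x y. cinner (T x) y = cinner x (S y)"
    by metis
  then have "\<forall>x y. cinner (T x) y = cinner x (cadjoint T y)"
    unfolding cadjoint_def by (rule someI_ex)
  then show ?thesis by blast
qed

lemma bounded_clinear_cadjoint:
  fixes T :: "'a::chilbert_space \<Rightarrow> 'b::complex_inner"
  assumes "bounded_clinear T"
  shows "bounded_clinear (cadjoint T)"
proof -
  note adj = cinner_cadjoint[OF assms, symmetric]
  obtain B where B0: "B \<ge> 0" and B: "\<And>x. norm (T x) \<le> B * norm x"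
    using bounded_clinear_bound[OF assms] by blast
  show ?thesis
  proof (rule bounded_clinearI)
    show "cadjoint T (x + y) = cadjoint T x + cadjoint T y" for x y
      by (rule cinner_ext[OF complex_vector.subspace_UNIV]) (simp_all add: cinner_add_right adj)
    show "cadjoint T (c *\<^sub>C x) = c *\<^sub>C cadjoint T x" for c x
      by (rule cinner_ext[OF complex_vector.subspace_UNIV]) (simp_all add: cinner_scaleC_right adj)
    show "norm (cadjoint T y) \<le> B * norm y" for y
    proof (cases "cadjoint T y = 0")
      case True
      then show ?thesis using B0 by simp
    next
      case False
      \<comment> \<open>Testing the adjoint identity at \<open>cadjoint T y\<close> itself leaves
        one factor of its norm to cancel.\<close>
      have "(norm (cadjoint T y))\<^sup>2 = cmod (cinner (T (cadjoint T y)) y)"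
        by (simp add: cinner_cadjoint[OF assms] cinner_self norm_power)
      also have "\<dots> \<le> B * norm (cadjoint T y) * norm y"
        using order_trans[OF cmod_cinner_le mult_right_mono[OF B norm_ge_zero]] .
      finally show ?thesis using False by (simp add: power2_eq_square mult.commute mult.left_commute)
    qed
  qed
qed

section \<open>Orthogonal families of subspaces\<close>

lemma csubspace_closure:
  assumes "csubspace (S :: 'a::complex_inner set)"
  shows "csubspace (closure S)"
proof (rule complex_vector.subspaceI)
  show "0 \<in> closure S"
    using complex_vector.subspace_0[OF assms] closure_subset by blast
next
  fix x y assume "x \<in> closure S" "y \<in> closure S"
  then obtain X Y where X: "\<And>i. X i \<in> S" "X \<longlonglongrightarrow> x" and Y: "\<And>i. Y i \<in> S" "Y \<longlonglongrightarrow> y"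
    unfolding closure_sequential by metis
  then have "\<forall>i. X i + Y i \<in> S" "(\<lambda>i. X i + Y i) \<longlonglongrightarrow> x + y"
    by (auto intro: complex_vector.subspace_add[OF assms] tendsto_add)
  then show "x + y \<in> closure S"
    unfolding closure_sequential by (intro exI[of _ "\<lambda>i. X i + Y i"] conjI)
next
  fix c :: complex and x assume "x \<in> closure S"
  then obtain X where X: "\<And>i. X i \<in> S" "X \<longlonglongrightarrow> x"
    unfolding closure_sequential by metis
  then have "\<forall>i. c *\<^sub>C X i \<in> S" "(\<lambda>i. c *\<^sub>C X i) \<longlonglongrightarrow> c *\<^sub>C x"
    by (auto intro: complex_vector.subspace_scale[OF assms]
        bounded_linear.tendsto[OF bounded_clinear_bounded_linear[OF
          bounded_clinear_scale[OF bounded_clinear_id]]])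
  then show "c *\<^sub>C x \<in> closure S"
    unfolding closure_sequential by (intro exI[of _ "\<lambda>i. c *\<^sub>C X i"] conjI)
qed

lemma closed_sum_minimal:
  assumes "csubspace S" "closed S" "\<And>i. i \<in> I \<Longrightarrow> F i \<subseteq> S"
  shows "closed_sum I F \<subseteq> S"
  unfolding closed_sum_def
  by (intro closure_minimal complex_vector.span_minimal assms(1,2) UN_least assms(3))

lemma csubspace_orthogonal: "csubspace {y. cinner x y = 0}"
  by (rule complex_vector.subspaceI) (simp_all add: cinner_add_right cinner_scaleC_right)

lemma closed_orthogonal: "closed {y. cinner x y = 0}"
  by (intro closed_Collect_eq linear_continuous_on bounded_linear_cinner_right continuous_on_const)

text \<open>The orthogonal complement of \<open>x\<close> is a closed subspace that contains all
  summands, hence contains \<open>x\<close>.\<close>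

lemma closed_sum_orthogonal_eq_0:
  assumes "closed_sum I F = UNIV" "\<And>i y. i \<in> I \<Longrightarrow> y \<in> F i \<Longrightarrow> cinner y x = 0"
  shows "x = 0"
proof -
  have "closed_sum I F \<subseteq> {y. cinner x y = 0}"
    by (rule closed_sum_minimal[OF csubspace_orthogonal closed_orthogonal])
       (use assms(2) cinner_swap_zero in blast)
  then have "x \<in> {y. cinner x y = 0}" using assms(1) by blast
  then show ?thesis by simp
qed

text \<open>Subtracting from \<open>x\<close> its projection to the closed sum leaves a vector
  orthogonal to every summand.\<close>

lemma closed_sum_eq_UNIV:
  fixes F :: "'i \<Rightarrow> 'a::chilbert_space set"
  assumes "\<And>x. (\<And>i y. i \<in> I \<Longrightarrow> y \<in> F i \<Longrightarrow> cinner y x = 0) \<Longrightarrow> x = 0"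
  shows "closed_sum I F = UNIV"
proof -
  have sub: "csubspace (closed_sum I F)" "closed (closed_sum I F)"
    by (simp_all add: closed_sum_def csubspace_closure)
  have "x \<in> closed_sum I F" for x
  proof -
    obtain z where z: "z \<in> closed_sum I F" "\<And>y. y \<in> closed_sum I F \<Longrightarrow> cinner y x = cinner y z"
      using adjoint_subspace[OF sub bounded_clinear_id] by metis
    have "x - z = 0"
    proof (rule assms)
      fix i y assume "i \<in> I" "y \<in> F i"
      then have "y \<in> closed_sum I F"
        unfolding closed_sum_def by (meson UN_I closure_subset complex_vector.span_base subsetD)
      then show "cinner y (x - z) = 0" by (simp add: cinner_diff_right z(2))
    qed
    with z(1) show ?thesis by simp
  qed
  then show ?thesis by blast
qed

text \<open>The set where two bounded maps agree is a closed subspace. This reduces the intertwining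
  relations to vectors of the form \<open>V_\<alpha> h\<close>.\<close>

lemma bounded_clinear_eq_on_closed_sum:
  assumes "bounded_clinear S" "bounded_clinear T" "closed_sum I F = UNIV"
    and "\<And>i y. i \<in> I \<Longrightarrow> y \<in> F i \<Longrightarrow> S y = T y"
  shows "S = T"
proof -
  have "csubspace {x. S x = T x}"
    by (rule complex_vector.subspaceI)
       (simp_all add: bounded_clinear_add[OF assms(1)] bounded_clinear_add[OF assms(2)]
         bounded_clinear_scaleC[OF assms(1)] bounded_clinear_scaleC[OF assms(2)]
         bounded_clinear_zero[OF assms(1)] bounded_clinear_zero[OF assms(2)])
  moreover have "closed {x. S x = T x}"
    by (intro closed_Collect_eq linear_continuous_on bounded_clinear_bounded_linear assms)
  ultimately have "closed_sum I F \<subseteq> {x. S x = T x}"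
    by (rule closed_sum_minimal) (use assms(4) in auto)
  then show ?thesis using assms(3) by auto
qed

section \<open>Coefficients in the l2 space and the unitary of a total orthogonal family\<close>

lemma cinner_l2_tensor: "cinner (l2_tensor i h) f = cinner h (Rep_l2 f i)"
proof -
  have "cinner (l2_tensor i h) f = (\<Sum>\<^sub>\<infinity>j. cinner (if j = i then h else 0) (Rep_l2 f j))"
    by (simp add: cinner_l2.rep_eq l2_tensor.rep_eq)
  also have "\<dots> = (\<Sum>\<^sub>\<infinity>j\<in>{i}. cinner h (Rep_l2 f j))"
    by (rule infsum_cong_neutral) auto
  finally show ?thesis by simp
qed

lemma bounded_clinear_Rep_l2: "bounded_clinear (\<lambda>f. Rep_l2 f i)"
  by (rule bounded_clinearI[where B = 1])
     (simp_all add: plus_l2.rep_eq scaleC_l2.rep_eq norm_Rep_l2_le)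

text \<open>The coefficient of \<open>U x\<close> at \<open>\<alpha>\<close> is the value at \<open>x\<close> of the adjoint of \<open>T \<alpha>\<close> restricted to \<open>L\<close>.\<close>

lemma unitary_of_orthogonal_family:
  fixes T :: "'i \<Rightarrow> 'a::chilbert_space \<Rightarrow> 'a" and L :: "'a set"
  assumes L: "csubspace L" "closed L"
    and T: "\<And>\<alpha>. \<alpha> \<in> I \<Longrightarrow> bounded_clinear (T \<alpha>)"
    and orth: "\<And>\<alpha> \<beta> h g. \<alpha> \<in> I \<Longrightarrow> \<beta> \<in> I \<Longrightarrow> h \<in> L \<Longrightarrow> g \<in> L \<Longrightarrow>
      cinner (T \<alpha> h) (T \<beta> g) = (if \<alpha> = \<beta> then cinner h g else 0)"
    and total: "closed_sum I (\<lambda>\<alpha>. T \<alpha> ` L) = UNIV"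
  obtains U where "bounded_clinear U"
    "unitary_betw UNIV {f. \<forall>\<alpha>. if \<alpha> \<in> I then Rep_l2 f \<alpha> \<in> L else Rep_l2 f \<alpha> = 0} U"
    "\<And>\<alpha> h. \<alpha> \<in> I \<Longrightarrow> h \<in> L \<Longrightarrow> U (T \<alpha> h) = l2_tensor \<alpha> h"
proof -
  have "\<exists>z\<in>L. \<forall>h\<in>L. cinner (T \<alpha> h) x = cinner h z" if "\<alpha> \<in> I" for \<alpha> x
    by (rule adjoint_subspace[OF L T[OF that], of x]) blast
  then obtain E where E: "\<And>\<alpha> x. \<alpha> \<in> I \<Longrightarrow> E \<alpha> x \<in> L"
    "\<And>\<alpha> x h. \<alpha> \<in> I \<Longrightarrow> h \<in> L \<Longrightarrow> cinner (T \<alpha> h) x = cinner h (E \<alpha> x)"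
    by metis
  have E_eqI: "E \<alpha> x = z" if "\<alpha> \<in> I" "z \<in> L" "\<And>h. h \<in> L \<Longrightarrow> cinner (T \<alpha> h) x = cinner h z" for \<alpha> x z
    by (rule cinner_ext[OF L(1)]) (use that E in auto)
  have E_add: "E \<alpha> (x + y) = E \<alpha> x + E \<alpha> y" if "\<alpha> \<in> I" for \<alpha> x y
    using that by (intro E_eqI) (auto simp: cinner_add_right E intro: complex_vector.subspace_add[OF L(1)])
  have E_scale: "E \<alpha> (c *\<^sub>C x) = c *\<^sub>C E \<alpha> x" if "\<alpha> \<in> I" for \<alpha> c x
    using that by (intro E_eqI) (auto simp: cinner_scaleC_right E intro: complex_vector.subspace_scale[OF L(1)])
  have E_T: "E \<alpha> (T \<beta> h) = (if \<alpha> = \<beta> then h else 0)" if "\<alpha> \<in> I" "\<beta> \<in> I" "h \<in> L" for \<alpha> \<beta> h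
    using that by (intro E_eqI) (auto simp: orth complex_vector.subspace_0[OF L(1)])
  define u where "u x \<alpha> = (if \<alpha> \<in> I then E \<alpha> x else 0)" for x \<alpha>
  \<comment> \<open>Bessel's inequality: the partial expansion \<open>s\<close> satisfies
    \<open>inner s s = inner s x\<close>, and \<open>x - s\<close> has nonnegative square
    norm.\<close>
  have bessel: "(\<Sum>\<alpha>\<in>F. (norm (u x \<alpha>))\<^sup>2) \<le> (norm x)\<^sup>2" if F: "finite F" for F x
  proof -
    define G where "G = F \<inter> I"
    define s where "s = (\<Sum>\<alpha>\<in>G. T \<alpha> (E \<alpha> x))"
    have G: "finite G" "\<And>\<alpha>. \<alpha> \<in> G \<Longrightarrow> \<alpha> \<in> I" using F by (auto simp: G_def)
    have 1: "cinner s x = (\<Sum>\<alpha>\<in>G. cinner (E \<alpha> x) (E \<alpha> x))"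
      unfolding s_def cinner_sum_left by (rule sum.cong) (auto simp: E G)
    have "cinner s s = (\<Sum>\<alpha>\<in>G. \<Sum>\<beta>\<in>G. if \<alpha> = \<beta> then cinner (E \<alpha> x) (E \<beta> x) else 0)"
      unfolding s_def cinner_sum_left cinner_sum_right
      by (intro sum.cong refl) (simp add: orth E(1) G(2))
    also have "\<dots> = cinner s x"
      unfolding 1 using G(1) by (intro sum.cong refl) simp
    finally have "inner s s = inner s x"
      by (simp flip: Re_cinner)
    moreover have "0 \<le> inner (x - s) (x - s)" by simp
    ultimately have "inner s x \<le> inner x x"
      by (simp add: inner_diff inner_commute)
    moreover have "(\<Sum>\<alpha>\<in>F. (norm (u x \<alpha>))\<^sup>2) = (\<Sum>\<alpha>\<in>G. (norm (E \<alpha> x))\<^sup>2)"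
      using F by (intro sum.mono_neutral_cong_right) (auto simp: u_def G_def)
    moreover have "(\<Sum>\<alpha>\<in>G. (norm (E \<alpha> x))\<^sup>2) = inner s x"
      using arg_cong[OF 1, of Re] by (simp add: Re_cinner power2_norm_eq_inner)
    ultimately show ?thesis by (simp add: power2_norm_eq_inner)
  qed
  have summ: "(\<lambda>\<alpha>. (norm (u x \<alpha>))\<^sup>2) summable_on UNIV" for x
    by (intro nonneg_bdd_above_summable_on bdd_aboveI2[where M = "(norm x)\<^sup>2"]) (auto simp: bessel)
  define U where "U x = Abs_l2 (u x)" for x
  have Rep_U: "Rep_l2 (U x) = u x" for x
    unfolding U_def by (rule Abs_l2_inverse) (simp add: summ)
  have U_bd: "bounded_clinear U"
  proof (rule bounded_clinearI)
    show "norm (U x) \<le> 1 * norm x" for x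
    proof -
      have "(norm (U x))\<^sup>2 \<le> (norm x)\<^sup>2"
        unfolding norm_l2_sq Rep_U by (intro infsum_le_finite_sums summ bessel)
      then show ?thesis by simp
    qed
    show "U (x + y) = U x + U y" for x y
      by (subst Rep_l2_inject[symmetric]) (auto simp: Rep_U plus_l2.rep_eq u_def E_add)
    show "U (c *\<^sub>C x) = c *\<^sub>C U x" for c x
      by (subst Rep_l2_inject[symmetric]) (auto simp: Rep_U scaleC_l2.rep_eq u_def E_scale)
  qed
  have U_T: "U (T \<alpha> h) = l2_tensor \<alpha> h" if "\<alpha> \<in> I" "h \<in> L" for \<alpha> h
    using that
    by (subst Rep_l2_inject[symmetric]) (auto simp: fun_eq_iff Rep_U l2_tensor.rep_eq u_def E_T)
  let ?B = "{f. \<forall>\<alpha>. if \<alpha> \<in> I then Rep_l2 f \<alpha> \<in> L else Rep_l2 f \<alpha> = 0}"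
  have U_in: "U x \<in> ?B" for x
    by (simp add: Rep_U u_def E(1))
  have iso: "cinner (U x) (U y) = cinner x y" for x y
  proof -
    \<comment> \<open>Here \<open>z\<close> is \<open>U* U y\<close>; equality with \<open>y\<close>
      is tested on the total family, where \<open>U\<close> is known explicitly.\<close>
    obtain z where z: "\<And>x. cinner (U x) (U y) = cinner x z"
      using adjoint_subspace[OF complex_vector.subspace_UNIV closed_UNIV U_bd, of "U y"] by auto
    have "z - y = 0"
    proof (rule closed_sum_orthogonal_eq_0[OF total])
      fix \<alpha> v assume "\<alpha> \<in> I" "v \<in> T \<alpha> ` L"
      then obtain h where v: "v = T \<alpha> h" "h \<in> L" by blast
      have "cinner v z = cinner h (E \<alpha> y)"
        using v \<open>\<alpha> \<in> I\<close> by (simp add: z[symmetric] U_T cinner_l2_tensor Rep_U u_def)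
      then show "cinner v (z - y) = 0"
        using v \<open>\<alpha> \<in> I\<close> by (simp add: cinner_diff_right E(2))
    qed
    then show ?thesis by (simp add: z)
  qed
  have "f \<in> range U" if f: "f \<in> ?B" for f
  proof -
    \<comment> \<open>The preimage of \<open>f\<close> is \<open>U* f\<close>; it has the right
      coefficients because pairing with \<open>l2_tensor \<alpha> h\<close> reads off the
      coefficient at \<open>\<alpha>\<close>.\<close>
    obtain y where y: "\<And>x. cinner (U x) f = cinner x y"
      using adjoint_subspace[OF complex_vector.subspace_UNIV closed_UNIV U_bd, of f] by auto
    have "Rep_l2 f \<alpha> = Rep_l2 (U y) \<alpha>" for \<alpha>
    proof (cases "\<alpha> \<in> I")
      case True
      show ?thesis
      proof (rule cinner_ext[OF L(1)])
        show "Rep_l2 f \<alpha> \<in> L" "Rep_l2 (U y) \<alpha> \<in> L"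
          using f U_in[of y] True by (auto split: if_splits)
        show "cinner h (Rep_l2 f \<alpha>) = cinner h (Rep_l2 (U y) \<alpha>)" if "h \<in> L" for h
          using U_T[OF True that] y[of "T \<alpha> h"] iso[of "T \<alpha> h" y] by (simp add: cinner_l2_tensor)
      qed
    next
      case False
      then have "Rep_l2 f \<alpha> = 0" using f by (simp split: if_splits)
      then show ?thesis using False by (simp add: Rep_U u_def)
    qed
    then have "f = U y" by (subst Rep_l2_inject[symmetric]) auto
    then show ?thesis by blast
  qed
  then have "unitary_betw UNIV ?B U"
    using U_bd U_in iso unfolding unitary_betw_def bounded_clinear_def by blast
  with U_bd show thesis using U_T by (rule that)
qed

section \<open>Pure and Cuntz row isometries\<close>

lemma word_op_conv_foldr: "word_op W \<alpha> = foldr W \<alpha>"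
  by (induction \<alpha>) (simp_all add: word_op_def fun_eq_iff)

lemma multi_word_op_conv_foldr:
  "multi_word_op k p V \<alpha> = foldr (\<lambda>j. foldr (V j) (\<alpha> j)) [p+1..<k+1]"
proof -
  have "foldr (\<lambda>j T. word_op (V j) (\<alpha> j) \<circ> T) js id = foldr (\<lambda>j. foldr (V j) (\<alpha> j)) js" for js
    by (induction js) (simp_all add: word_op_conv_foldr fun_eq_iff)
  then show ?thesis unfolding multi_word_op_def .
qed

locale row_isometry_tuple =
  fixes m :: nat and W :: "nat \<Rightarrow> 'a::chilbert_space \<Rightarrow> 'a"
  assumes row_isometry: "row_isometry m W"
begin

context
  notes atLeastAtMost_iff [simp del] One_nat_def [simp del]
begin

lemma bounded: "s \<in> {1..m} \<Longrightarrow> bounded_clinear (W s)"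
  using row_isometry unfolding row_isometry_def by blast

lemma adjoint: "s \<in> {1..m} \<Longrightarrow> cinner (W s x) y = cinner x (cadjoint (W s) y)"
  by (rule cinner_cadjoint[OF bounded])

lemma adjoint': "s \<in> {1..m} \<Longrightarrow> cinner y (W s x) = cinner (cadjoint (W s) y) x"
  by (metis adjoint cinner_commute)

lemma cadjoint_apply:
  "s \<in> {1..m} \<Longrightarrow> t \<in> {1..m} \<Longrightarrow> cadjoint (W s) (W t x) = (if s = t then x else 0)"
  using row_isometry unfolding row_isometry_def by blast

lemma cinner_apply:
  "s \<in> {1..m} \<Longrightarrow> t \<in> {1..m} \<Longrightarrow> cinner (W s x) (W t y) = (if s = t then cinner x y else 0)"
  by (simp add: adjoint cadjoint_apply)

lemma bounded_word: "\<beta> \<in> lists {1..m} \<Longrightarrow> bounded_clinear (foldr W \<beta>)"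
  using bounded_clinear_foldr[of \<beta> W] bounded by (auto simp: lists_eq_set)

text \<open>Taking adjoints reverses the order of the letters, so the first letter acts first:
  \<open>fold\<close> instead of \<open>foldr\<close>.\<close>

lemma adjoint_word:
  "\<beta> \<in> lists {1..m} \<Longrightarrow> cinner (foldr W \<beta> x) y = cinner x (fold (\<lambda>s. cadjoint (W s)) \<beta> y)"
  by (induction \<beta> arbitrary: y rule: lists.induct) (auto simp: adjoint)

lemma word_invariant:
  assumes "\<And>s x. s \<in> {1..m} \<Longrightarrow> x \<in> N \<Longrightarrow> W s x \<in> N"
  shows "\<beta> \<in> lists {1..m} \<Longrightarrow> x \<in> N \<Longrightarrow> foldr W \<beta> x \<in> N"
  by (induction \<beta> rule: lists.induct) (auto intro: assms)

lemma word_adjoint_invariant: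
  assumes "\<And>s x. s \<in> {1..m} \<Longrightarrow> x \<in> N \<Longrightarrow> cadjoint (W s) x \<in> N"
  shows "\<beta> \<in> lists {1..m} \<Longrightarrow> x \<in> N \<Longrightarrow> fold (\<lambda>s. cadjoint (W s)) \<beta> x \<in> N"
  by (induction \<beta> arbitrary: x rule: lists.induct) (auto intro: assms)

text \<open>Equal first letters cancel, different ones have orthogonal ranges, and a word left over
  against the empty one is killed by its first adjoint letter.\<close>

lemma cinner_words:
  assumes "\<And>s. s \<in> {1..m} \<Longrightarrow> cadjoint (W s) x = 0" "\<And>s. s \<in> {1..m} \<Longrightarrow> cadjoint (W s) y = 0"
  shows "\<beta> \<in> lists {1..m} \<Longrightarrow> \<gamma> \<in> lists {1..m} \<Longrightarrow>
    cinner (foldr W \<beta> x) (foldr W \<gamma> y) = (if \<beta> = \<gamma> then cinner x y else 0)"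
proof (induction \<beta> arbitrary: \<gamma> rule: lists.induct)
  case Nil
  from Nil show ?case by (cases \<gamma>) (auto simp: adjoint' assms)
next
  case (Cons s \<beta>)
  from Cons.prems Cons.hyps Cons.IH[of "tl \<gamma>"] show ?case
    by (cases \<gamma>) (auto simp: adjoint assms cadjoint_apply)
qed

text \<open>Substitute \<open>x = \<Sum> W_s W_s* x\<close> into itself \<open>l\<close> times. The
  coefficients remain in \<open>N\<close>, and as the sums are finite no closure is taken.\<close>

lemma cuntz_span:
  assumes cuntz: "cuntz m W" and adj: "\<And>s x. s \<in> {1..m} \<Longrightarrow> x \<in> N \<Longrightarrow> cadjoint (W s) x \<in> N"
  shows "x \<in> N \<Longrightarrow> x \<in> cspan (\<Union>\<beta>\<in>{\<beta>\<in>lists {1..m}. length \<beta> = l}. foldr W \<beta> ` N)"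
proof (induction l arbitrary: x)
  case 0
  then show ?case by (intro complex_vector.span_base) auto
next
  case (Suc l)
  let ?G = "\<lambda>l. \<Union>\<beta>\<in>{\<beta>\<in>lists {1..m}. length \<beta> = l}. foldr W \<beta> ` N"
  have "W s (cadjoint (W s) x) \<in> cspan (?G (Suc l))" if s: "s \<in> {1..m}" for s
  proof (rule bounded_clinear_span_image[OF bounded[OF s] _ Suc.IH[OF adj[OF s Suc.prems]]])
    fix g assume "g \<in> ?G l"
    then obtain \<beta> y where "\<beta> \<in> lists {1..m}" "length \<beta> = l" "y \<in> N" "g = foldr W \<beta> y" by blast
    then have "W s g \<in> ?G (Suc l)" using s by (auto intro!: exI[of _ "s # \<beta>"])
    then show "W s g \<in> cspan (?G (Suc l))" by (rule complex_vector.span_base)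
  qed simp
  then have "(\<Sum>s\<in>{1..m}. W s (cadjoint (W s) x)) \<in> cspan (?G (Suc l))"
    by (intro complex_vector.span_sum)
  then show ?case using cuntz by (simp add: cuntz_def)
qed

section \<open>Pure row isometries on reducing subspaces\<close>

text \<open>
  Let \<open>y\<close> be the projection of \<open>x\<close> to \<open>N\<close> and \<open>z = W\<^bsub>\<beta>\<^esub>\<^sup>* y\<close>. The defect \<open>z - \<Sum>\<^sub>s W\<^sub>s W\<^sub>s\<^sup>* z\<close> lies in
  \<open>N \<inter> \<Inter>\<^sub>s ker W\<^sub>s\<^sup>*\<close>, so it is orthogonal to \<open>z\<close> and hence vanishes. As the wandering space \<open>M\<close> of a
  pure \<open>W\<close> is killed by all \<open>W\<^sub>s\<^sup>*\<close>, it follows that \<open>y\<close> is orthogonal to every \<open>W\<^bsub>\<beta>\<^esub> M\<close>.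
\<close>

lemma pure_orthogonal:
  assumes pure: "pure m W" and N: "csubspace N" "closed N"
    and inv: "\<And>s x. s \<in> {1..m} \<Longrightarrow> x \<in> N \<Longrightarrow> W s x \<in> N"
    and adj: "\<And>s x. s \<in> {1..m} \<Longrightarrow> x \<in> N \<Longrightarrow> cadjoint (W s) x \<in> N"
    and orth: "\<And>\<beta> h. \<beta> \<in> lists {1..m} \<Longrightarrow> h \<in> N \<Longrightarrow> (\<And>s. s \<in> {1..m} \<Longrightarrow> cadjoint (W s) h = 0) \<Longrightarrow>
      cinner (foldr W \<beta> h) x = 0"
    and "h \<in> N"
  shows "cinner h x = 0"
proof -
  obtain y where y: "y \<in> N" "\<And>h. h \<in> N \<Longrightarrow> cinner h x = cinner h y"
    using adjoint_subspace[OF N bounded_clinear_id] by metis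
  have fix_point: "z = (\<Sum>s\<in>{1..m}. W s (cadjoint (W s) z))"
    if \<beta>: "\<beta> \<in> lists {1..m}" and z: "z = fold (\<lambda>s. cadjoint (W s)) \<beta> y" for \<beta> z
  proof -
    define d where "d = z - (\<Sum>s\<in>{1..m}. W s (cadjoint (W s) z))"
    have zN: "z \<in> N" unfolding z by (rule word_adjoint_invariant[OF adj \<beta> y(1)])
    have dN: "d \<in> N"
      unfolding d_def by (intro complex_vector.subspace_diff complex_vector.subspace_sum N zN inv adj)
    have dW: "cadjoint (W t) d = 0" if t: "t \<in> {1..m}" for t
    proof -
      have "(\<Sum>s\<in>{1..m}. cadjoint (W t) (W s (cadjoint (W s) z)))
          = (\<Sum>s\<in>{1..m}. if t = s then cadjoint (W s) z else 0)"
        using t by (intro sum.cong) (simp_all add: cadjoint_apply)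
      then show ?thesis
        using t unfolding d_def
        by (simp add: bounded_clinear_diff[OF bounded_clinear_cadjoint[OF bounded]]
            bounded_clinear_sum[OF bounded_clinear_cadjoint[OF bounded]])
    qed
    \<comment> \<open>Moving the adjoint word back puts \<open>foldr W \<beta> d\<close> into
      \<open>N\<close>, where \<open>y\<close> and \<open>x\<close> have the same inner products;
      then \<open>orth\<close> applies to \<open>d\<close>.\<close>
    have "cinner d z = cinner (foldr W \<beta> d) y"
      by (simp add: adjoint_word[OF \<beta>] z)
    also have "\<dots> = 0"
      using orth[OF \<beta> dN dW] y(2)[OF word_invariant[OF inv \<beta> dN]] by simp
    \<comment> \<open>The subtracted sum in \<open>d\<close> is orthogonal to \<open>d\<close> by
      \<open>dW\<close>, so only the pairing with \<open>z\<close> remains.\<close>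
    finally have "cinner d d = 0"
      by (subst (2) d_def) (simp add: cinner_diff_right cinner_sum_right adjoint' dW)
    then show ?thesis by (simp add: d_def)
  qed
  obtain M where M: "\<And>\<alpha>. \<alpha> \<in> lists {1..m} \<Longrightarrow> length \<alpha> \<ge> 1 \<Longrightarrow> orthogonal_sets M (word_op W \<alpha> ` M)"
    and total: "closed_sum (lists {1..m}) (\<lambda>\<alpha>. word_op W \<alpha> ` M) = UNIV"
    using pure unfolding pure_def by (elim exE conjE) blast
  \<comment> \<open>For \<open>v = W_\<alpha> u\<close> the pairing of \<open>v\<close> with
    \<open>W_s* g\<close> is that of \<open>W_s W_\<alpha> u\<close> with \<open>g\<close>, and
    \<open>s # \<alpha>\<close> is a nonempty word.\<close>
  have ker: "cadjoint (W s) g = 0" if s: "s \<in> {1..m}" and g: "g \<in> M" for s g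
  proof (rule closed_sum_orthogonal_eq_0[OF total])
    fix \<alpha> v assume \<alpha>: "\<alpha> \<in> lists {1..m}" and "v \<in> word_op W \<alpha> ` M"
    then obtain u where u: "u \<in> M" "v = foldr W \<alpha> u" by (auto simp: word_op_conv_foldr)
    have "cinner g (foldr W (s # \<alpha>) u) = 0"
      using M[of "s # \<alpha>"] s \<alpha> g u(1) by (simp add: orthogonal_sets_def word_op_conv_foldr)
    then show "cinner v (cadjoint (W s) g) = 0"
      by (metis adjoint cinner_swap_zero comp_apply foldr.simps(2) s u(2))
  qed
  have "y = 0"
  proof (rule closed_sum_orthogonal_eq_0[OF total])
    fix \<alpha> v assume \<alpha>: "\<alpha> \<in> lists {1..m}" and "v \<in> word_op W \<alpha> ` M"
    then obtain g where g: "g \<in> M" "v = foldr W \<alpha> g" by (auto simp: word_op_conv_foldr)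
    have "cinner v y = cinner g (fold (\<lambda>s. cadjoint (W s)) \<alpha> y)"
      by (simp add: g adjoint_word[OF \<alpha>])
    \<comment> \<open>The fixed-point identity writes the second argument as a sum of vectors in the
      ranges of the \<open>W_s\<close>, which \<open>g\<close> annihilates.\<close>
    also have "\<dots> = 0"
      by (subst fix_point[OF \<alpha> refl]) (simp add: cinner_sum_right adjoint' ker g(1))
    finally show "cinner v y = 0" .
  qed
  then show ?thesis using y(2)[OF \<open>h \<in> N\<close>] by simp
qed

end

end

section \<open>Doubly commuting row isometries\<close>

lemma multi_words_empty: "multi_words n {} = {\<lambda>_. []}"
  by (auto simp: multi_words_def)

lemma multi_words_upd:
  "\<alpha> \<in> multi_words n J \<Longrightarrow> \<beta> \<in> lists {1..n j} \<Longrightarrow> \<alpha>(j := \<beta>) \<in> multi_words n (insert j J)"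
  by (auto simp: multi_words_def)

text \<open>Padding by empty words outside \<open>J\<close> makes the entries in \<open>J\<close>
  decisive.\<close>

lemma multi_words_eq_iff:
  "\<alpha> \<in> multi_words n J \<Longrightarrow> \<beta> \<in> multi_words n J \<Longrightarrow> (\<forall>j\<in>J. \<alpha> j = \<beta> j) \<longleftrightarrow> \<alpha> = \<beta>"
  by (auto simp: multi_words_def fun_eq_iff)

locale doubly_commuting_tuple =
  fixes k :: nat and n :: "nat \<Rightarrow> nat" and lam :: "nat \<Rightarrow> nat \<Rightarrow> nat \<Rightarrow> nat \<Rightarrow> complex"
    and V :: "nat \<Rightarrow> nat \<Rightarrow> 'a::chilbert_space \<Rightarrow> 'a"
  assumes twist: "twist_matrices k n lam"
    and row_isometries: "\<forall>i\<in>{1..k}. row_isometry (n i) (V i)"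
    and doubly_commuting: "doubly_commuting k n lam V"
begin

text \<open>The head of the index list gives the outermost factor. Lists \<open>[1..<p+1]\<close>
  and \<open>[p+1..<k+1]\<close> give the products of the pure and of the Cuntz part; inductions
  peel off single indices.\<close>

abbreviation "tuple_op \<alpha> \<equiv> foldr (\<lambda>j. foldr (V j) (\<alpha> j))"

lemma row: "i \<in> {1..k} \<Longrightarrow> row_isometry_tuple (n i) (V i)"
  using row_isometries by (simp add: row_isometry_tuple_def)

lemmas bounded_V = row_isometry_tuple.bounded[OF row]
  and adjoint_V = row_isometry_tuple.adjoint[OF row]
  and cinner_V = row_isometry_tuple.cinner_apply[OF row]

lemma adjoint_commute:
  assumes "i \<in> {1..k}" "j \<in> {1..k}" "i \<noteq> j" "s \<in> {1..n i}" "t \<in> {1..n j}"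
  shows "cadjoint (V i s) (V j t x) = cnj (lam i j s t) *\<^sub>C V j t (cadjoint (V i s) x)"
  using doubly_commuting assms unfolding doubly_commuting_def by blast

text \<open>The square of the norm of the difference of the two sides is \<open>(1 - \<bar>\<lambda>\<bar>\<^sup>2) \<parallel>x\<parallel>\<^sup>2 = 0\<close>.\<close>

lemma commute:
  assumes "i \<in> {1..k}" "j \<in> {1..k}" "i \<noteq> j" "s \<in> {1..n i}" "t \<in> {1..n j}"
  shows "V i s (V j t x) = lam i j s t *\<^sub>C V j t (V i s x)"
proof -
  define l where "l = lam i j s t"
  define a where "a = V i s (V j t x)"
  define b where "b = V j t (V i s x)"
  have "cmod l = 1"
    using twist assms unfolding twist_matrices_def l_def by blast
  then have l: "l * cnj l = 1"
    by (simp add: complex_norm_square[symmetric])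
  have aa: "cinner a a = cinner x x" and bb: "cinner b b = cinner x x"
    using assms by (simp_all only: a_def b_def cinner_V simp_thms if_True)
  \<comment> \<open>Double commutation carries the adjoint past \<open>V j t\<close>, where it
    cancels \<open>V i s\<close>.\<close>
  have "cadjoint (V i s) b = cnj l *\<^sub>C V j t x"
    using assms unfolding b_def l_def
    by (simp only: adjoint_commute row_isometry_tuple.cadjoint_apply[OF row] simp_thms if_True)
  then have ab: "cinner a b = l * cinner x x"
    using assms unfolding a_def adjoint_V[OF assms(1,4)]
    by (simp only: cinner_scaleC_right complex_cnj_cnj cinner_V simp_thms if_True)
  then have ba: "cinner b a = cnj l * cinner x x"
    by (metis aa cinner_commute complex_cnj_mult)
  have "cinner (a - l *\<^sub>C b) (a - l *\<^sub>C b) = cinner x x - l * cnj l * cinner x x"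
    by (simp add: cinner_diff_left cinner_diff_right cinner_scaleC_left cinner_scaleC_right
        aa bb ab ba algebra_simps)
  then have "a - l *\<^sub>C b = 0" by (simp add: l)
  then show ?thesis by (simp add: a_def b_def l_def)
qed

section \<open>The joint kernel is closed and reduces the remaining row isometries\<close>

lemma kernel_meet_csubspace:
  assumes "p \<le> k"
  shows "csubspace (kernel_meet n p V)"
  unfolding complex_vector.subspace_def kernel_meet_def
  using assms bounded_clinear_cadjoint[OF bounded_V]
  by (auto simp: bounded_clinear_zero bounded_clinear_add bounded_clinear_scaleC)

lemma kernel_meet_closed:
  assumes "p \<le> k"
  shows "closed (kernel_meet n p V)"
proof -
  have "closed {x. cadjoint (V i s) x = 0}" if "i \<in> {1..p}" "s \<in> {1..n i}" for i s
    using that assms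
    by (intro closed_Collect_eq linear_continuous_on bounded_clinear_bounded_linear
        bounded_clinear_cadjoint bounded_V continuous_on_const) auto
  then have "closed (\<Inter>i\<in>{1..p}. \<Inter>s\<in>{1..n i}. {x. cadjoint (V i s) x = 0})"
    by blast
  also have "(\<Inter>i\<in>{1..p}. \<Inter>s\<in>{1..n i}. {x. cadjoint (V i s) x = 0}) = kernel_meet n p V"
    unfolding kernel_meet_def by blast
  finally show ?thesis .
qed

lemma kernel_meet_invariant:
  assumes "j \<in> {p+1..k}" "t \<in> {1..n j}" "x \<in> kernel_meet n p V"
  shows "V j t x \<in> kernel_meet n p V"
  unfolding kernel_meet_def
proof (intro CollectI ballI)
  fix i s assume "i \<in> {1..p}" "s \<in> {1..n i}"
  moreover from this have "cadjoint (V i s) x = 0"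
    using assms(3) by (simp add: kernel_meet_def)
  ultimately show "cadjoint (V i s) (V j t x) = 0"
    using assms(1,2) by (subst adjoint_commute) (auto simp: bounded_clinear_zero[OF bounded_V])
qed

text \<open>Exchanging two adjoints is the dual of \<open>commute\<close>; it is carried out weakly,
  after pairing with a vector \<open>z\<close>.\<close>

lemma kernel_meet_adjoint_invariant:
  assumes "j \<in> {p+1..k}" "t \<in> {1..n j}" "x \<in> kernel_meet n p V"
  shows "cadjoint (V j t) x \<in> kernel_meet n p V"
  unfolding kernel_meet_def
proof (intro CollectI ballI)
  fix i s assume i: "i \<in> {1..p}" and s: "s \<in> {1..n i}"
  have ij: "i \<in> {1..k}" "j \<in> {1..k}" "j \<noteq> i" using i assms(1) by auto
  show "cadjoint (V i s) (cadjoint (V j t) x) = 0"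
  proof (rule cinner_ext[OF complex_vector.subspace_UNIV UNIV_I UNIV_I])
    fix z
    have "cinner z (cadjoint (V i s) (cadjoint (V j t) x)) = cinner (V j t (V i s z)) x"
      using ij s assms(2) by (simp only: adjoint_V)
    also have "\<dots> = lam j i t s * cinner (V i s (V j t z)) x"
      by (simp only: commute[OF ij(2,1,3) assms(2) s] cinner_scaleC_left)
    also have "\<dots> = lam j i t s * cinner z (cadjoint (V j t) (cadjoint (V i s) x))"
      using ij s assms(2) by (simp only: adjoint_V)
    also have "cadjoint (V i s) x = 0"
      using assms(3) i s by (simp add: kernel_meet_def)
    finally show "cinner z (cadjoint (V i s) (cadjoint (V j t) x)) = cinner z 0"
      using ij assms(2) by (simp add: bounded_clinear_zero[OF bounded_clinear_cadjoint[OF bounded_V]])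
  qed
qed

section \<open>Orthogonality and totality of the products of words\<close>

lemma bounded_tuple:
  assumes "set js \<subseteq> {1..k}" "\<And>j. j \<in> set js \<Longrightarrow> \<alpha> j \<in> lists {1..n j}"
  shows "bounded_clinear (tuple_op \<alpha> js)"
  using assms by (intro bounded_clinear_foldr row_isometry_tuple.bounded_word[OF row]) auto

lemma tuple_invariant:
  assumes "\<And>j s y. j \<in> set js \<Longrightarrow> s \<in> {1..n j} \<Longrightarrow> y \<in> N \<Longrightarrow> V j s y \<in> N"
    and "set js \<subseteq> {1..k}" "\<And>j. j \<in> set js \<Longrightarrow> \<alpha> j \<in> lists {1..n j}" "x \<in> N"
  shows "tuple_op \<alpha> js x \<in> N"
  using assms(1-3)
proof (induction js)
  case Nil
  then show ?case using assms(4) by simp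
next
  case (Cons j js)
  have "foldr (V j) (\<alpha> j) (tuple_op \<alpha> js x) \<in> N"
    by (rule row_isometry_tuple.word_invariant[OF row]) (use Cons in auto)
  then show ?case by simp
qed

lemma tuple_cong: "(\<And>j. j \<in> set js \<Longrightarrow> \<alpha> j = \<beta> j) \<Longrightarrow> tuple_op \<alpha> js = tuple_op \<beta> js"
  by (rule ext, rule foldr_cong) auto

lemma cinner_tuple:
  assumes "p \<le> k" "h \<in> kernel_meet n p V" "g \<in> kernel_meet n p V"
    and \<alpha>: "\<alpha> \<in> multi_words n {1..p}" and \<beta>: "\<beta> \<in> multi_words n {1..p}"
  shows "cinner (tuple_op \<alpha> [1..<p+1] h) (tuple_op \<beta> [1..<p+1] g) = (if \<alpha> = \<beta> then cinner h g else 0)"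
proof -
  \<comment> \<open>Downward induction on the number \<open>q\<close> of factors removed from the
    left: the products are empty at \<open>q = p\<close>, and \<open>q = 0\<close> is the
    claim.\<close>
  have "cinner (tuple_op \<alpha> [q+1..<p+1] h) (tuple_op \<beta> [q+1..<p+1] g) =
      (if \<forall>j\<in>{q+1..p}. \<alpha> j = \<beta> j then cinner h g else 0)" if "q \<le> p" for q
    using that
  proof (induction rule: inc_induct)
    case base
    then show ?case by simp
  next
    case (step q)
    \<comment> \<open>The factors with index above \<open>q+1\<close> preserve the joint kernel of
      the first \<open>q+1\<close> row isometries, so what follows the leading word is a wandering
      vector for \<open>V (q+1)\<close>.\<close>
    have ker: "cadjoint (V (q+1) s) (tuple_op \<gamma> [Suc q+1..<p+1] f) = 0"
      if "\<gamma> \<in> multi_words n {1..p}" "f \<in> kernel_meet n p V" "s \<in> {1..n (q+1)}" for \<gamma> f s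
    proof -
      have "tuple_op \<gamma> [Suc q+1..<p+1] f \<in> kernel_meet n (q+1) V"
      proof (rule tuple_invariant)
        show "f \<in> kernel_meet n (q+1) V"
          using that(2) step.hyps by (auto simp: kernel_meet_def)
      qed (use that(1) assms(1) in \<open>auto simp: multi_words_def intro!: kernel_meet_invariant\<close>)
      then show ?thesis using that(3) by (auto simp: kernel_meet_def)
    qed
    have split: "[q+1..<p+1] = (q+1) # [Suc q+1..<p+1]" "{q+1..p} = insert (q+1) {Suc q+1..p}"
      using step.hyps by (auto simp: upt_conv_Cons)
    have words: "\<alpha> (q+1) \<in> lists {1..n (q+1)}" "\<beta> (q+1) \<in> lists {1..n (q+1)}"
      using \<alpha> \<beta> step.hyps by (auto simp: multi_words_def)
    have "q+1 \<in> {1..k}" using step.hyps assms(1) by auto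
    from row_isometry_tuple.cinner_words[OF row[OF this] ker[OF \<alpha> assms(2)] ker[OF \<beta> assms(3)] words]
    show ?case
      unfolding split(1) foldr.simps comp_apply split(2) ball_simps(7) step.IH by simp
  qed
  from this[of 0] show ?thesis
    using multi_words_eq_iff[OF \<alpha> \<beta>] by simp
qed

lemma wold_total:
  assumes "p \<le> k" "\<And>i. i \<in> {1..p} \<Longrightarrow> pure (n i) (V i)"
    and "\<And>\<alpha> h. \<alpha> \<in> multi_words n {1..p} \<Longrightarrow> h \<in> kernel_meet n p V \<Longrightarrow>
      cinner (tuple_op \<alpha> [1..<p+1] h) x = 0"
  shows "x = 0"
  using assms
proof (induction p)
  case 0
  \<comment> \<open>For \<open>p = 0\<close> the only product is the identity and the kernel is the
    whole space, so \<open>x\<close> is orthogonal to itself.\<close>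
  from 0(3)[of "\<lambda>_. []" x] show ?case by (simp add: multi_words_empty kernel_meet_def)
next
  case (Suc p)
  show ?case
  proof (rule Suc.IH)
    fix \<alpha> h assume \<alpha>: "\<alpha> \<in> multi_words n {1..p}" and h: "h \<in> kernel_meet n p V"
    let ?T = "tuple_op \<alpha> [1..<p+1]"
    have T: "bounded_clinear ?T"
      using \<alpha> Suc.prems(1) by (intro bounded_tuple) (auto simp: multi_words_def)
    have row_p: "row_isometry_tuple (n (Suc p)) (V (Suc p))"
      using Suc.prems(1) by (intro row) auto
    \<comment> \<open>With the first \<open>p\<close> words moved to the other side, purity of
      \<open>V (Suc p)\<close> is applied inside the reducing subspace
      \<open>kernel_meet n p V\<close>.\<close>
    have "cinner h (cadjoint ?T x) = 0"
    proof (rule row_isometry_tuple.pure_orthogonal[OF row_p, where N = "kernel_meet n p V"])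
      fix \<beta> g assume \<beta>: "\<beta> \<in> lists {1..n (Suc p)}" and g: "g \<in> kernel_meet n p V"
        and "\<And>s. s \<in> {1..n (Suc p)} \<Longrightarrow> cadjoint (V (Suc p) s) g = 0"
      then have g': "g \<in> kernel_meet n (Suc p) V"
        by (auto simp: kernel_meet_def le_Suc_eq)
      have "cinner (foldr (V (Suc p)) \<beta> g) (cadjoint ?T x) = cinner (?T (foldr (V (Suc p)) \<beta> g)) x"
        by (rule cinner_cadjoint[OF T, symmetric])
      also have "?T (foldr (V (Suc p)) \<beta> g) =
          tuple_op (\<alpha>(Suc p := \<beta>)) [1..<p+1] (foldr (V (Suc p)) \<beta> g)"
        by (rule fun_cong[OF tuple_cong]) auto
      also have "\<dots> = tuple_op (\<alpha>(Suc p := \<beta>)) [1..<Suc p+1] g"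
        by simp
      also have "cinner \<dots> x = 0"
      proof (rule Suc.prems(3)[OF _ g'])
        show "\<alpha>(Suc p := \<beta>) \<in> multi_words n {1..Suc p}"
          using multi_words_upd[OF \<alpha> \<beta>] by (simp add: atLeastAtMostSuc_conv)
      qed
      finally show "cinner (foldr (V (Suc p)) \<beta> g) (cadjoint ?T x) = 0" .
    qed (use Suc.prems(1,2) h kernel_meet_csubspace kernel_meet_closed kernel_meet_invariant
        kernel_meet_adjoint_invariant in auto)
    then show "cinner (?T h) x = 0" by (simp only: cinner_cadjoint[OF T])
  qed (use Suc.prems in auto)
qed

section \<open>Cuntz expansions and the wandering subspace\<close>

lemma cuntz_tuple_span:
  assumes cuntz: "\<And>j. j \<in> {p+1..k} \<Longrightarrow> cuntz (n j) (V j)"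
    and adj: "\<And>j s x. j \<in> {p+1..k} \<Longrightarrow> s \<in> {1..n j} \<Longrightarrow> x \<in> N \<Longrightarrow> cadjoint (V j s) x \<in> N"
    and "p \<le> k" "x \<in> N"
  shows "x \<in> cspan (\<Union>\<alpha>\<in>{\<alpha> \<in> multi_words n {p+1..k}. \<forall>j\<in>{p+1..k}. length (\<alpha> j) = m j}.
    tuple_op \<alpha> [p+1..<k+1] ` N)"
proof -
  let ?I = "\<lambda>q. {\<alpha> \<in> multi_words n {q+1..k}. \<forall>j\<in>{q+1..k}. length (\<alpha> j) = m j}"
  let ?G = "\<lambda>q. \<Union>\<alpha>\<in>?I q. tuple_op \<alpha> [q+1..<k+1] ` N"
  from assms(3,4) show "x \<in> cspan (?G p)"
  proof (induction arbitrary: x rule: inc_induct)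
    case base
    then show ?case by (intro complex_vector.span_base) (simp add: multi_words_empty)
  next
    case (step q)
    let ?j = "q + 1"
    have j: "?j \<in> {1..k}" "?j \<in> {p+1..k}" using step.hyps by auto
    \<comment> \<open>By induction \<open>y\<close> expands in products over the later indices;
      prefixing \<open>\<beta>\<close> fills the entry \<open>q+1\<close>, which was empty.\<close>
    have word: "foldr (V ?j) \<beta> y \<in> cspan (?G q)"
      if \<beta>: "\<beta> \<in> lists {1..n ?j}" "length \<beta> = m ?j" and y: "y \<in> N" for \<beta> y
    proof (rule bounded_clinear_span_image[OF row_isometry_tuple.bounded_word[OF row[OF j(1)] \<beta>(1)] _ step.IH[OF y]])
      fix g assume "g \<in> ?G (Suc q)"
      then obtain \<alpha> z where \<alpha>: "\<alpha> \<in> ?I (Suc q)" and z: "z \<in> N" "g = tuple_op \<alpha> [Suc q+1..<k+1] z"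
        by blast
      have split: "[q+1..<k+1] = ?j # [Suc q+1..<k+1]" "{q+1..k} = insert ?j {Suc q+1..k}"
        using step.hyps by (auto simp: upt_conv_Cons)
      have "\<alpha>(?j := \<beta>) \<in> ?I q"
        unfolding split(2) using \<alpha> \<beta> multi_words_upd by auto
      moreover have "tuple_op \<alpha> [Suc q+1..<k+1] = tuple_op (\<alpha>(?j := \<beta>)) [Suc q+1..<k+1]"
        by (rule tuple_cong) auto
      then have "foldr (V ?j) \<beta> g = tuple_op (\<alpha>(?j := \<beta>)) [q+1..<k+1] z"
        unfolding split(1) z(2) by (simp del: upt_Suc)
      ultimately have "foldr (V ?j) \<beta> g \<in> ?G q" using z(1) by blast
      then show "foldr (V ?j) \<beta> g \<in> cspan (?G q)" by (rule complex_vector.span_base)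
    qed simp
    have "x \<in> cspan (\<Union>\<beta>\<in>{\<beta>\<in>lists {1..n ?j}. length \<beta> = m ?j}. foldr (V ?j) \<beta> ` N)"
      by (intro row_isometry_tuple.cuntz_span[OF row[OF j(1)] cuntz[OF j(2)] adj[OF j(2)] step.prems])
    then show ?case
      by (rule subsetD[OF complex_vector.span_minimal[OF _ complex_vector.subspace_span], rotated])
         (use word in blast)
  qed
qed

text \<open>Already for each single length profile \<open>m\<close> the closed sum is the joint
  kernel: invariance gives one inclusion, the Cuntz expansion the other. The intersection over
  \<open>m\<close> is therefore constant.\<close>

lemma wandering_subspace_eq:
  assumes "p \<le> k" "\<And>j. j \<in> {p+1..k} \<Longrightarrow> cuntz (n j) (V j)"
  shows "wandering_subspace k n p V = kernel_meet n p V"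
proof -
  let ?N = "kernel_meet n p V"
  have "closed_sum {\<alpha> \<in> multi_words n {p+1..k}. \<forall>j\<in>{p+1..k}. length (\<alpha> j) = m j}
      (\<lambda>\<alpha>. tuple_op \<alpha> [p+1..<k+1] ` ?N) = ?N" for m :: "nat \<Rightarrow> nat"
  proof (rule equalityI)
    show "closed_sum {\<alpha> \<in> multi_words n {p+1..k}. \<forall>j\<in>{p+1..k}. length (\<alpha> j) = m j}
      (\<lambda>\<alpha>. tuple_op \<alpha> [p+1..<k+1] ` ?N) \<subseteq> ?N"
      by (rule closed_sum_minimal[OF kernel_meet_csubspace[OF assms(1)] kernel_meet_closed[OF assms(1)]],
          intro image_subsetI tuple_invariant)
         (auto simp: multi_words_def intro!: kernel_meet_invariant)
    show "?N \<subseteq> closed_sum {\<alpha> \<in> multi_words n {p+1..k}. \<forall>j\<in>{p+1..k}. length (\<alpha> j) = m j}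
      (\<lambda>\<alpha>. tuple_op \<alpha> [p+1..<k+1] ` ?N)"
      unfolding closed_sum_def
      by (intro subsetI subsetD[OF closure_subset] cuntz_tuple_span assms kernel_meet_adjoint_invariant)
  qed
  then show ?thesis
    unfolding wandering_subspace_def multi_word_op_conv_foldr by simp
qed

section \<open>Moving one entry past a product of words\<close>

lemma V_word:
  assumes "i \<in> {1..k}" "j \<in> {1..k}" "i \<noteq> j" "s \<in> {1..n i}"
  shows "\<beta> \<in> lists {1..n j} \<Longrightarrow> V i s (foldr (V j) \<beta> x) = lam_word lam i j s \<beta> *\<^sub>C foldr (V j) \<beta> (V i s x)"
proof (induction \<beta> rule: lists.induct)
  case Nil
  then show ?case by (simp add: lam_word_def)
next
  case (Cons t \<beta>)
  then show ?case
    by (simp add: commute[OF assms Cons.hyps(1)] bounded_clinear_scaleC[OF bounded_V[OF assms(2) Cons.hyps(1)]]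
        lam_word_def scaleC_scaleC)
qed

lemma V_tuple:
  assumes "i \<in> {1..k}" "s \<in> {1..n i}" "set js \<subseteq> {1..k} - {i}" "distinct js"
    and "\<And>j. j \<in> set js \<Longrightarrow> \<alpha> j \<in> lists {1..n j}"
  shows "V i s (tuple_op \<alpha> js x) = (\<Prod>j\<in>set js. lam_word lam i j s (\<alpha> j)) *\<^sub>C tuple_op \<alpha> js (V i s x)"
  using assms(3-5)
proof (induction js)
  case (Cons j js)
  have j: "j \<in> {1..k}" "i \<noteq> j" "\<alpha> j \<in> lists {1..n j}" using Cons.prems by auto
  have IH: "V i s (tuple_op \<alpha> js x) = (\<Prod>j\<in>set js. lam_word lam i j s (\<alpha> j)) *\<^sub>C tuple_op \<alpha> js (V i s x)"
    using Cons.prems by (intro Cons.IH) auto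
  have "V i s (tuple_op \<alpha> (j # js) x) = lam_word lam i j s (\<alpha> j) *\<^sub>C foldr (V j) (\<alpha> j) (V i s (tuple_op \<alpha> js x))"
    by (simp add: V_word[OF assms(1) j(1,2) assms(2) j(3)])
  also have "\<dots> = (lam_word lam i j s (\<alpha> j) * (\<Prod>j\<in>set js. lam_word lam i j s (\<alpha> j))) *\<^sub>C
      tuple_op \<alpha> (j # js) (V i s x)"
    by (simp add: IH bounded_clinear_scaleC[OF row_isometry_tuple.bounded_word[OF row[OF j(1)] j(3)]]
        scaleC_scaleC)
  finally show ?case using Cons.prems by simp
qed simp

text \<open>\<open>V i s\<close> passes the words with index below \<open>i\<close> and is then
  absorbed as a new first letter of \<open>\<alpha> i\<close>, which is the formula for
  \<open>std_S\<close> on elementary tensors.\<close>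

lemma V_tuple_pure:
  assumes "p \<le> k" "i \<in> {1..p}" "s \<in> {1..n i}" "\<alpha> \<in> multi_words n {1..p}"
  shows "V i s (tuple_op \<alpha> [1..<p+1] x) =
    (\<Prod>j\<in>{1..<i}. lam_word lam i j s (\<alpha> j)) *\<^sub>C tuple_op (\<alpha>(i := s # \<alpha> i)) [1..<p+1] x"
proof -
  have split: "[1..<p+1] = [1..<i] @ i # [i+1..<p+1]"
    using assms(2) upt_add_eq_append[of 1 i "p + 1 - i"] by (simp add: upt_conv_Cons)
  have "tuple_op (\<alpha>(i := s # \<alpha> i)) [1..<p+1] x =
      tuple_op \<alpha> [1..<i] (V i s (foldr (V i) (\<alpha> i) (tuple_op \<alpha> [i+1..<p+1] x)))"
  proof -
    have "tuple_op (\<alpha>(i := s # \<alpha> i)) [1..<i] = tuple_op \<alpha> [1..<i]"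
      "tuple_op (\<alpha>(i := s # \<alpha> i)) [i+1..<p+1] = tuple_op \<alpha> [i+1..<p+1]"
      by (rule tuple_cong; auto)+
    then show ?thesis unfolding split by (simp del: upt_Suc)
  qed
  moreover have "V i s (tuple_op \<alpha> [1..<i] y) =
      (\<Prod>j\<in>{1..<i}. lam_word lam i j s (\<alpha> j)) *\<^sub>C tuple_op \<alpha> [1..<i] (V i s y)" for y
  proof -
    have "{1..<i} \<subseteq> {1..k} - {i}" using assms(1,2) by auto
    then show ?thesis
      using V_tuple[of i s "[1..<i]" \<alpha> y] assms by (auto simp: multi_words_def)
  qed
  ultimately show ?thesis
    unfolding split by (simp del: upt_Suc)
qed

text \<open>As \<open>i > p\<close>, all \<open>p\<close> words are passed and \<open>V i s\<close>
  reaches \<open>x\<close>, which matches \<open>std_W\<close>.\<close>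

lemma V_tuple_cuntz:
  assumes "i \<in> {p+1..k}" "s \<in> {1..n i}" "\<alpha> \<in> multi_words n {1..p}"
  shows "V i s (tuple_op \<alpha> [1..<p+1] x) =
    (\<Prod>j\<in>{1..p}. lam_word lam i j s (\<alpha> j)) *\<^sub>C tuple_op \<alpha> [1..<p+1] (V i s x)"
proof -
  have "set [1..<p+1] = {1..p}" "{1..p} \<subseteq> {1..k} - {i}"
    using assms(1) by auto
  then show ?thesis
    using V_tuple[of i s "[1..<p+1]" \<alpha> x] assms by (auto simp: multi_words_def simp del: upt_Suc set_upt)
qed

text \<open>Uniform in \<open>p\<close>, the extreme values 0 and \<open>k\<close> included. Both
  intertwining relations are verified coefficient by coefficient on the total family.\<close>

lemma wold_equivalence:
  fixes p
  defines "L \<equiv> kernel_meet n p V"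
  assumes "p \<le> k" "\<And>i. i \<in> {1..p} \<Longrightarrow> pure (n i) (V i)"
  shows "unitarily_equivalent k n UNIV V (fock_space n p L) (std_tuple lam p (\<lambda>j t. restrict (V j t) L))"
proof -
  let ?I = "multi_words n {1..p}" and ?T = "\<lambda>\<alpha>. tuple_op \<alpha> [1..<p+1]"
    and ?W = "\<lambda>j t. restrict (V j t) L"
  have bounded: "bounded_clinear (?T \<alpha>)" if "\<alpha> \<in> ?I" for \<alpha>
    using that assms(2) by (intro bounded_tuple) (auto simp: multi_words_def)
  have L: "csubspace L" "closed L"
    unfolding L_def using kernel_meet_csubspace kernel_meet_closed assms(2) by auto
  have orth: "cinner (?T \<alpha> h) (?T \<beta> g) = (if \<alpha> = \<beta> then cinner h g else 0)"
    if "\<alpha> \<in> ?I" "\<beta> \<in> ?I" "h \<in> L" "g \<in> L" for \<alpha> \<beta> h g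
    using that cinner_tuple[OF assms(2)] unfolding L_def by blast
  have total: "closed_sum ?I (\<lambda>\<alpha>. ?T \<alpha> ` L) = UNIV"
    by (rule closed_sum_eq_UNIV, rule wold_total[OF assms(2,3)]) (auto simp: L_def)
  obtain U where U: "bounded_clinear U" "unitary_betw UNIV (fock_space n p L) U"
    "\<And>\<alpha> h. \<alpha> \<in> ?I \<Longrightarrow> h \<in> L \<Longrightarrow> U (?T \<alpha> h) = l2_tensor \<alpha> h"
    using unitary_of_orthogonal_family[of L ?I ?T, OF L bounded orth total]
    unfolding fock_space_def by blast
  have U_in: "U x \<in> fock_space n p L" for x
    using U(2) by (auto simp: unitary_betw_def)
  have U_coeff: "bounded_clinear (\<lambda>x. Rep_l2 (U x) \<gamma>)" for \<gamma>
    by (rule bounded_clinear_compose[OF bounded_clinear_Rep_l2 U(1)])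
  have U_scale: "U (c *\<^sub>C x) = c *\<^sub>C U x" for c x
    by (rule bounded_clinear_scaleC[OF U(1)])
  \<comment> \<open>Coefficients off the index set are 0, which lies in \<open>L\<close>; hence
    \<open>restrict\<close> never takes its default value on a coefficient.\<close>
  have Rep_L: "Rep_l2 (U x) \<gamma> \<in> L" for x \<gamma>
    using U_in[of x] complex_vector.subspace_0[OF L(1)]
    unfolding fock_space_def by (auto split: if_splits)
  have S: "U (V i s x) = std_S lam i s (U x)" if i: "i \<in> {1..p}" and s: "s \<in> {1..n i}" for i s x
  proof -
    have "Rep_l2 (U (V i s x)) \<gamma> = Rep_l2 (std_S lam i s (U x)) \<gamma>" for \<gamma>
    proof -
      \<comment> \<open>For fixed \<open>\<gamma>\<close> the scalar \<open>c\<close> is independent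
        of the vector, so both coefficients are bounded linear functions of it. Linearity of
        \<open>std_S\<close> on the whole l2 space is thus avoided.\<close>
      define c where "c = (if \<gamma> i \<noteq> [] \<and> hd (\<gamma> i) = s
        then \<Prod>j\<in>{1..<i}. lam_word lam i j s (\<gamma> j) else 0)"
      have Rep_S: "Rep_l2 (std_S lam i s (U y)) \<gamma> = c *\<^sub>C Rep_l2 (U y) (\<gamma>(i := tl (\<gamma> i)))" for y
        unfolding Rep_std_S[OF twist assms(2) i s U_in] c_def by simp
      have "(\<lambda>y. Rep_l2 (U (V i s y)) \<gamma>) = (\<lambda>y. c *\<^sub>C Rep_l2 (U y) (\<gamma>(i := tl (\<gamma> i))))"
      proof (rule bounded_clinear_eq_on_closed_sum[OF _ _ total])
        show "bounded_clinear (\<lambda>y. Rep_l2 (U (V i s y)) \<gamma>)"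
          using i s assms(2) by (intro bounded_clinear_compose[OF U_coeff] bounded_V) auto
        show "bounded_clinear (\<lambda>y. c *\<^sub>C Rep_l2 (U y) (\<gamma>(i := tl (\<gamma> i))))"
          by (rule bounded_clinear_scale[OF U_coeff])
        fix \<alpha> y assume \<alpha>: "\<alpha> \<in> ?I" and "y \<in> ?T \<alpha> ` L"
        then obtain h where h: "h \<in> L" "y = ?T \<alpha> h" by blast
        have \<alpha>': "\<alpha>(i := s # \<alpha> i) \<in> ?I"
          using \<alpha> i s by (auto simp: multi_words_def)
        have "U (V i s y) = std_S lam i s (U y)"
          unfolding h(2) V_tuple_pure[OF assms(2) i s \<alpha>] U_scale U(3)[OF \<alpha> h(1)] std_S_tensor
            U(3)[OF \<alpha>' h(1)] by (rule refl)
        then show "Rep_l2 (U (V i s y)) \<gamma> = c *\<^sub>C Rep_l2 (U y) (\<gamma>(i := tl (\<gamma> i)))"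
          by (simp add: Rep_S)
      qed
      then show ?thesis by (simp add: Rep_S fun_eq_iff)
    qed
    then show ?thesis by (subst Rep_l2_inject[symmetric]) auto
  qed
  have W: "U (V i s x) = std_W lam p ?W i s (U x)" if i: "i \<in> {p+1..k}" and s: "s \<in> {1..n i}" for i s x
  proof -
    have ik: "i \<in> {1..k}" using i by auto
    \<comment> \<open>The restricted operator is undefined off \<open>L\<close>; its value at 0 is
      the proper one since \<open>0 \<in> L\<close>.\<close>
    have W0: "?W i s 0 = 0"
      using complex_vector.subspace_0[OF L(1)] bounded_clinear_zero[OF bounded_V[OF ik s]] by simp
    obtain B where B: "\<And>x. norm (V i s x) \<le> B * norm x"
      using bounded_clinear_bound[OF bounded_V[OF ik s]] by blast
    have "Rep_l2 (U (V i s x)) \<gamma> = Rep_l2 (std_W lam p ?W i s (U x)) \<gamma>" for \<gamma>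
    proof -
      define c where "c = (\<Prod>j\<in>{1..p}. lam_word lam i j s (\<gamma> j))"
      have Rep_W: "Rep_l2 (std_W lam p ?W i s (U y)) \<gamma> = c *\<^sub>C V i s (Rep_l2 (U y) \<gamma>)" for y
        using Rep_std_W[OF twist i s U_in[of y], of ?W B, OF W0] B Rep_L unfolding c_def by simp
      have "(\<lambda>y. Rep_l2 (U (V i s y)) \<gamma>) = (\<lambda>y. c *\<^sub>C V i s (Rep_l2 (U y) \<gamma>))"
      proof (rule bounded_clinear_eq_on_closed_sum[OF _ _ total])
        show "bounded_clinear (\<lambda>y. Rep_l2 (U (V i s y)) \<gamma>)"
          by (rule bounded_clinear_compose[OF U_coeff bounded_V[OF ik s]])
        show "bounded_clinear (\<lambda>y. c *\<^sub>C V i s (Rep_l2 (U y) \<gamma>))"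
          by (intro bounded_clinear_scale bounded_clinear_compose[OF bounded_V[OF ik s] U_coeff])
        fix \<alpha> y assume \<alpha>: "\<alpha> \<in> ?I" and "y \<in> ?T \<alpha> ` L"
        then obtain h where h: "h \<in> L" "y = ?T \<alpha> h" by blast
        \<comment> \<open>Invariance of \<open>L\<close> lets \<open>U\<close> send
          \<open>?T \<alpha> (V i s h)\<close> to an elementary tensor at the same
          \<open>\<alpha>\<close>.\<close>
        have Vh: "V i s h \<in> L"
          using kernel_meet_invariant[OF i s] h(1) by (simp add: L_def)
        have "U (V i s y) = std_W lam p ?W i s (U y)"
          unfolding h(2) V_tuple_cuntz[OF i s \<alpha>] U_scale U(3)[OF \<alpha> h(1)]
            std_W_tensor[of ?W, OF W0] U(3)[OF \<alpha> Vh]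
          by (simp add: h(1))
        then show "Rep_l2 (U (V i s y)) \<gamma> = c *\<^sub>C V i s (Rep_l2 (U y) \<gamma>)"
          by (simp add: Rep_W)
      qed
      then show ?thesis by (simp add: Rep_W fun_eq_iff)
    qed
    then show ?thesis by (subst Rep_l2_inject[symmetric]) auto
  qed
  show ?thesis
    unfolding unitarily_equivalent_def std_tuple_def using U(2) S W by (intro exI[of _ U]) auto
qed

end

theorem theorem2p2:
  fixes k p :: nat
    and n :: "nat \<Rightarrow> nat"
    and lam :: "nat \<Rightarrow> nat \<Rightarrow> nat \<Rightarrow> nat \<Rightarrow> complex"
    and V :: "nat \<Rightarrow> nat \<Rightarrow> 'a::chilbert_space \<Rightarrow> 'a"
    and L :: "'a set"
    and Wt :: "nat \<Rightarrow> nat \<Rightarrow> 'a \<Rightarrow> 'a"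
  assumes "k \<ge> 1" and "p \<le> k" and "\<forall>i\<in>{1..k}. n i \<ge> 1"
    and "twist_matrices k n lam"
    and "\<forall>i\<in>{1..k}. row_isometry (n i) (V i)"
    and "doubly_commuting k n lam V"
    and "\<forall>i\<in>{1..p}. pure (n i) (V i)"
    and "\<forall>i\<in>{p+1..k}. cuntz (n i) (V i)"
    and "L = wandering_subspace k n p V"
    and "Wt = (\<lambda>j t. restrict (V j t) L)"
  shows "(1 \<le> p \<and> p < k \<longrightarrow>
            unitarily_equivalent k n UNIV V (fock_space n p L) (std_tuple lam p Wt)) \<and>
         (p = 0 \<longrightarrow> L = UNIV \<and> unitarily_equivalent k n UNIV V UNIV V) \<and>
         (p = k \<longrightarrow> unitarily_equivalent k n UNIV V (fock_space n k L) (std_S lam))"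
proof -
  interpret doubly_commuting_tuple k n lam V
    by unfold_locales (fact assms)+
  have L: "L = kernel_meet n p V"
    unfolding assms(9) using assms(2,8) by (intro wandering_subspace_eq) blast+
  have equiv: "unitarily_equivalent k n UNIV V (fock_space n p L) (std_tuple lam p Wt)"
    unfolding assms(10) L using assms(2,7) by (intro wold_equivalence) auto
  \<comment> \<open>No kernel condition is left for \<open>p = 0\<close>, and the identity is the
    required unitary.\<close>
  moreover have "L = UNIV \<and> unitarily_equivalent k n UNIV V UNIV V" if "p = 0"
    unfolding L unitarily_equivalent_def unitary_betw_def clinear_on_def using that
    by (auto simp: kernel_meet_def intro!: exI[of _ "\<lambda>x. x"])
  \<comment> \<open>For \<open>p = k\<close> every index satisfies \<open>i \<le> p\<close>, so
    \<open>std_tuple\<close> always selects \<open>std_S\<close>.\<close>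
  moreover have "unitarily_equivalent k n UNIV V (fock_space n k L) (std_S lam)" if "p = k"
    using equiv that by (simp add: unitarily_equivalent_def std_tuple_def)
  ultimately show ?thesis by blast
qed

end
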